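(* Consider the plant, the data matrices $U_1,\Psi_0,\Psi_1$ and the unknown matrix $W_0$ defined in the context. Assume: all eigenvalues of $S$ belong to $\{z\in\mathbb{C}: |z|\ge 1\}$; the pair $(A,C)$ is observable with (known) observability index $\ell$; and there are a matrix $\hat L_0$ and a (known) matrix $\hat{\mathbf M}\in\mathbb{R}^{\hat n_w\times(T-\ell+1)}$ such that $W_0=\hat L_0\hat{\mathbf M}$. Let $N:=(m+p)\ell+pd$ and suppose that the semidefinite program $$\mathcal X\succ 0,\qquad \begin{bmatrix}\mathcal X\\ 0_{\hat n_w,N}\end{bmatrix}=\begin{bmatrix}\Psi_0\\ \hat{\mathbf M}\end{bmatrix}\mathcal Y,\qquad \begin{bmatrix}\mathcal X & \Psi_1\mathcal Y\\ (\Psi_1\mathcal Y)^\top & \mathcal X\end{bmatrix}\succ 0$$ in the decision variables $\mathcal X\in\mathbb{R}^{N\times N}$ symmetric and $\mathcal Y\in\mathbb{R}^{(T-\ell+1)\times N}$ is feasible, and let $\mathcal K:=U_1\mathcal Y\mathcal X^{-1}$ for a feasible $(\mathcal X,\mathcal Y)$. Then the controller $$\chi^+=\mathbf F\chi+\mathbf Ly+\mathbf Bu,\qquad \eta^+=\Phi\eta+Gy,\qquad u=\mathcal K\begin{bmatrix}\chi\\ \eta\end{bmatrix}$$ solves the output regulation problem for the plant, that is, the closed loop $$w^+=Sw,\quad x^+=Ax+Bu+Pw,\quad y=Cx+Qw,\quad \chi^+=\mathbf F\chi+\mathbf Ly+\mathbf Bu,\quad \eta^+=\Phi\eta+Gy,\quad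 u=\mathcal K\begin{bmatrix}\chi\\ \eta\end{bmatrix}$$ (i) is globally asymptotically stable with $w=0$ (i.e. the origin of the resulting $(x,\chi,\eta)$-dynamics is globally asymptotically stable), and (ii) satisfies $\lim_{k\to\infty}y(k)=0$ for each initial condition $(w(0),x(0),\chi(0),\eta(0))$.
   Context: All vectors and matrices are real. $x^+$ denotes the value of $x$ at the next time step (discrete time); $M\succ0$ means symmetric positive definite; $I$ and $0$ are identity and zero matrices; $(x_1,\dots,x_k)$ denotes the stacked column vector. Plant: $w^+=Sw$, $x^+=Ax+Bu+Pw$, $y=Cx+Qw$ with $w\in\mathbb{R}^{n_w}$ (exosignal), $x\in\mathbb{R}^n$, $u\in\mathbb{R}^m$, $y\in\mathbb{R}^p$. $S$ is known; $A,B,P,C,Q$, $w$, $x$ are unknown to the designer. Observability index: if $(A,C)$ is observable, $\ell$ is the smallest integer $l\ge1$ such that the stacked matrix with block rows $C,CA,\dots,CA^{l-1}$ has rank $n$. Internal model: let $\lambda^d+s_{d-1}\lambda^{d-1}+\dots+s_1\lambda+s_0$ be the minimal polynomial of $S$. $\Phi\in\mathbb{R}^{pd\times pd}$ is the block companion matrix with $d\times d$ blocks of size $p\times p$: for $i=1,\dots,d-1$ its $i$-th block row has $I_p$ in block column $i+1$ and zeros elsewhere, and its last block row is $[-s_0I_p,\,-s_1I_p,\dots,-s_{d-1}I_p]$. $G\in\mathbb{R}^{pd\times p}$ has $I_p$ as last block and zeros elsewhere. The internal model is $\eta^+=\Phi\eta+Gy$. Data: for an integer $T\ge\ell$, a trajectory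 of the plant and of the internal model is collected in an experiment (arbitrary initial $w(0),x(0),\eta(0)$ and input sequence $u(0),\dots,u(T)$). For $k=\ell,\dots,T+1$ let $\psi(k):=(y(k-\ell),\dots,y(k-1),u(k-\ell),\dots,u(k-1),\eta(k))\in\mathbb{R}^{(m+p)\ell+pd}$, evaluated along the experiment. Define $U_1:=[u(\ell)\ u(\ell+1)\ \cdots\ u(T)]$, $\Psi_0:=[\psi(\ell)\ \psi(\ell+1)\ \cdots\ \psi(T)]$, $\Psi_1:=[\psi(\ell+1)\ \psi(\ell+2)\ \cdots\ \psi(T+1)]$, $W_0:=[w(\ell)\ w(\ell+1)\ \cdots\ w(T)]$. The matrices $U_1,\Psi_0,\Psi_1$ are known; $W_0$ is not. (The closed-loop solutions in the conclusion are unrelated to the experiment, with arbitrary initial conditions.) Controller matrices: on $\mathbb{R}^{(p+m)\ell}$, with vectors partitioned as $(a_1,\dots,a_\ell,b_1,\dots,b_\ell)$, $a_i\in\mathbb{R}^p$, $b_i\in\mathbb{R}^m$: $\mathbf F$ is the matrix of $(a_1,\dots,a_\ell,b_1,\dots,b_\ell)\mapsto(a_2,\dots,a_\ell,0,b_2,\dots,b_\ell,0)$; $\mathbf L\in\mathbb{R}^{(p+m)\ell\times p}$ is the matrix of $a\mapsto(0,\dots,0,a,0,\dots,0)$ with $a$ in position $a_\ell$; $\mathbf B\in\mathbb{R}^{(p+m)\ell\times m}$ is the matrix of $b\mapsto(0,\dots,0,b)$ with $b$ in position $b_\ell$. The controller states are $\chi\in\mathbb{R}^{(p+m)\ell}$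 and $\eta\in\mathbb{R}^{pd}$. *)

theory Defs
  imports
    "Jordan_Normal_Form.DL_Rank"
    "Jordan_Normal_Form.Gauss_Jordan_Elimination"
    "Jordan_Normal_Form.Char_Poly"
begin

text \<open>
  The sizes of the matrices below depend on values (the degree of a minimal polynomial, an
  observability index), so vectors and matrices are the ones with explicit carriers. Blocks and
  block entries are indexed from 0.
\<close>

definition euclid_norm :: "real vec \<Rightarrow> real" where
  "euclid_norm v = sqrt (scalar_prod v v)"

definition stack_vecs :: "'a :: zero vec list \<Rightarrow> 'a vec" where
  "stack_vecs vs = foldr append_vec vs (0\<^sub>v 0)"

definition pos_def :: "real mat \<Rightarrow> bool" where
  "pos_def M \<longleftrightarrow> square_mat M \<and> transpose_mat M = M \<and>
     (\<forall>v \<in> carrier_vec (dim_row M). v \<noteq> 0\<^sub>v (dim_row M) \<longrightarrow> 0 < scalar_prod v (M *\<^sub>v v))"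

definition poly_mat :: "'a :: comm_ring_1 poly \<Rightarrow> 'a mat \<Rightarrow> 'a mat" where
  "poly_mat q S = mat (dim_row S) (dim_row S)
     (\<lambda>(i, j). \<Sum>k\<le>degree q. coeff q k * (S ^\<^sub>m k) $$ (i, j))"

definition is_minimal_poly :: "'a :: field mat \<Rightarrow> 'a poly \<Rightarrow> bool" where
  "is_minimal_poly S q \<longleftrightarrow> lead_coeff q = 1 \<and> poly_mat q S = 0\<^sub>m (dim_row S) (dim_row S) \<and>
     (\<forall>r. r \<noteq> 0 \<and> poly_mat r S = 0\<^sub>m (dim_row S) (dim_row S) \<longrightarrow> degree q \<le> degree r)"

definition observability_mat :: "'a :: field mat \<Rightarrow> 'a mat \<Rightarrow> nat \<Rightarrow> 'a mat" where
  "observability_mat A C l =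
     foldr append_rows (map (\<lambda>k. C * (A ^\<^sub>m k)) [0..<l]) (0\<^sub>m 0 (dim_row A))"

definition observability_rank :: "'a :: field mat \<Rightarrow> 'a mat \<Rightarrow> nat \<Rightarrow> nat" where
  "observability_rank A C l = vec_space.rank (dim_row C * l) (observability_mat A C l)"

definition observable :: "'a :: field mat \<Rightarrow> 'a mat \<Rightarrow> bool" where
  "observable A C \<longleftrightarrow> observability_rank A C (dim_row A) = dim_row A"

definition observability_index :: "'a :: field mat \<Rightarrow> 'a mat \<Rightarrow> nat" where
  "observability_index A C = (LEAST l. 1 \<le> l \<and> observability_rank A C l = dim_row A)"

text \<open>Entry \<open>(i, j)\<close> lies in block \<open>(i div p, j div p)\<close>, at position \<open>(i mod p, j mod p)\<close>.\<close>

definition im_Phi :: "nat \<Rightarrow> 'a :: comm_ring_1 poly \<Rightarrow> 'a mat" where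
  "im_Phi p q = (let d = degree q in mat (p * d) (p * d) (\<lambda>(i, j).
     if i div p = d - 1 then (if i mod p = j mod p then - coeff q (j div p) else 0)
     else if j = i + p then 1 else 0))"

definition im_G :: "nat \<Rightarrow> nat \<Rightarrow> 'a :: comm_ring_1 mat" where
  "im_G p d = mat (p * d) p (\<lambda>(i, j). if i = p * (d - 1) + j then 1 else 0)"

text \<open>\<open>block_shift q l\<close> is the matrix of \<open>(a\<^sub>1, \<dots>, a\<^sub>l) \<mapsto> (a\<^sub>2, \<dots>, a\<^sub>l, 0)\<close> with blocks of size \<open>q\<close>.\<close>

definition block_shift :: "nat \<Rightarrow> nat \<Rightarrow> 'a :: comm_ring_1 mat" where
  "block_shift q l = mat (q * l) (q * l) (\<lambda>(i, j). if j = i + q then 1 else 0)"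

definition ctrl_F :: "nat \<Rightarrow> nat \<Rightarrow> nat \<Rightarrow> 'a :: comm_ring_1 mat" where
  "ctrl_F p m l = four_block_mat
     (block_shift p l) (0\<^sub>m (p * l) (m * l))
     (0\<^sub>m (m * l) (p * l)) (block_shift m l)"

definition ctrl_L :: "nat \<Rightarrow> nat \<Rightarrow> nat \<Rightarrow> 'a :: comm_ring_1 mat" where
  "ctrl_L p m l = mat ((p + m) * l) p (\<lambda>(i, j). if i = p * (l - 1) + j then 1 else 0)"

definition ctrl_B :: "nat \<Rightarrow> nat \<Rightarrow> nat \<Rightarrow> 'a :: comm_ring_1 mat" where
  "ctrl_B p m l = mat ((p + m) * l) m (\<lambda>(i, j). if i = p * l + m * (l - 1) + j then 1 else 0)"

text \<open>
  In the following two predicates \<open>I\<close> is the set of times at which the equations are imposed. It is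
  \<open>{..T}\<close> for the experiment and \<open>UNIV\<close> for closed-loop solutions.
\<close>

definition plant_traj :: "nat set \<Rightarrow> real mat \<Rightarrow> real mat \<Rightarrow> real mat \<Rightarrow> real mat \<Rightarrow> real mat \<Rightarrow> real mat
    \<Rightarrow> (nat \<Rightarrow> real vec) \<Rightarrow> (nat \<Rightarrow> real vec) \<Rightarrow> (nat \<Rightarrow> real vec) \<Rightarrow> (nat \<Rightarrow> real vec) \<Rightarrow> bool" where
  "plant_traj I S A B P C Q w x u y \<longleftrightarrow> (\<forall>k\<in>I.
     w k \<in> carrier_vec (dim_row S) \<and> x k \<in> carrier_vec (dim_row A) \<and> u k \<in> carrier_vec (dim_col B) \<and>
     w (Suc k) = S *\<^sub>v w k \<and>
     x (Suc k) = A *\<^sub>v x k + B *\<^sub>v u k + P *\<^sub>v w k \<and>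
     y k = C *\<^sub>v x k + Q *\<^sub>v w k)"

definition im_traj :: "nat set \<Rightarrow> real mat \<Rightarrow> real mat
    \<Rightarrow> (nat \<Rightarrow> real vec) \<Rightarrow> (nat \<Rightarrow> real vec) \<Rightarrow> bool" where
  "im_traj I \<Phi> G y \<eta> \<longleftrightarrow> (\<forall>k\<in>I.
     \<eta> k \<in> carrier_vec (dim_row \<Phi>) \<and> \<eta> (Suc k) = \<Phi> *\<^sub>v \<eta> k + G *\<^sub>v y k)"

definition psi :: "nat \<Rightarrow> (nat \<Rightarrow> real vec) \<Rightarrow> (nat \<Rightarrow> real vec) \<Rightarrow> (nat \<Rightarrow> real vec)
    \<Rightarrow> nat \<Rightarrow> real vec" where
  "psi l y u \<eta> k = stack_vecs (map y [k - l..<k] @ map u [k - l..<k] @ [\<eta> k])"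

text \<open>The matrix with columns \<open>f a, \<dots>, f b\<close>, each of dimension \<open>nr\<close>.\<close>

definition data_mat :: "nat \<Rightarrow> (nat \<Rightarrow> 'a vec) \<Rightarrow> nat \<Rightarrow> nat \<Rightarrow> 'a mat" where
  "data_mat nr f a b = mat_of_cols nr (map f [a..<Suc b])"

definition sdp_feasible :: "real mat \<Rightarrow> real mat \<Rightarrow> real mat \<Rightarrow> real mat \<Rightarrow> real mat \<Rightarrow> bool" where
  "sdp_feasible \<Psi>0 \<Psi>1 M X Y \<longleftrightarrow>
     X \<in> carrier_mat (dim_row \<Psi>0) (dim_row \<Psi>0) \<and> Y \<in> carrier_mat (dim_col \<Psi>0) (dim_row \<Psi>0) \<and>
     pos_def X \<and>
     X @\<^sub>r 0\<^sub>m (dim_row M) (dim_row \<Psi>0) = (\<Psi>0 @\<^sub>r M) * Y \<and>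
     pos_def (four_block_mat X (\<Psi>1 * Y) (transpose_mat (\<Psi>1 * Y)) X)"

definition closed_loop :: "real mat \<Rightarrow> real mat \<Rightarrow> real mat \<Rightarrow> real mat \<Rightarrow> real mat \<Rightarrow> real mat
    \<Rightarrow> real mat \<Rightarrow> real mat \<Rightarrow> real mat \<Rightarrow> real mat \<Rightarrow> real mat \<Rightarrow> real mat
    \<Rightarrow> (nat \<Rightarrow> real vec) \<Rightarrow> (nat \<Rightarrow> real vec) \<Rightarrow> (nat \<Rightarrow> real vec) \<Rightarrow> (nat \<Rightarrow> real vec)
    \<Rightarrow> (nat \<Rightarrow> real vec) \<Rightarrow> (nat \<Rightarrow> real vec) \<Rightarrow> bool" where
  "closed_loop S A B P C Q F L Bc \<Phi> G K w x \<chi> \<eta> u y \<longleftrightarrow>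
     plant_traj UNIV S A B P C Q w x u y \<and>
     im_traj UNIV \<Phi> G y \<eta> \<and>
     (\<forall>k. \<chi> k \<in> carrier_vec (dim_row F) \<and> \<chi> (Suc k) = F *\<^sub>v \<chi> k + L *\<^sub>v y k + Bc *\<^sub>v u k) \<and>
     (\<forall>k. u k = K *\<^sub>v (\<chi> k @\<^sub>v \<eta> k))"

text \<open>Global asymptotic stability (Lyapunov stability and global attractivity) of the origin, for a
  system given by its set of solutions.\<close>

definition origin_gas :: "(nat \<Rightarrow> real vec) set \<Rightarrow> bool" where
  "origin_gas Z \<longleftrightarrow>
     (\<forall>\<epsilon>>0. \<exists>\<delta>>0. \<forall>z\<in>Z. euclid_norm (z 0) < \<delta> \<longrightarrow> (\<forall>k. euclid_norm (z k) < \<epsilon>)) \<and>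
     (\<forall>z\<in>Z. (\<lambda>k. euclid_norm (z k)) \<longlonglongrightarrow> 0)"

definition solves_output_regulation :: "real mat \<Rightarrow> real mat \<Rightarrow> real mat \<Rightarrow> real mat \<Rightarrow> real mat
    \<Rightarrow> real mat \<Rightarrow> real mat \<Rightarrow> real mat \<Rightarrow> real mat \<Rightarrow> real mat \<Rightarrow> real mat \<Rightarrow> real mat \<Rightarrow> bool" where
  "solves_output_regulation S A B P C Q F L Bc \<Phi> G K \<longleftrightarrow>
     origin_gas {z. \<exists>x \<chi> \<eta> u y.
       closed_loop S A B P C Q F L Bc \<Phi> G K (\<lambda>_. 0\<^sub>v (dim_row S)) x \<chi> \<eta> u y \<and>
       z = (\<lambda>k. x k @\<^sub>v \<chi> k @\<^sub>v \<eta> k)} \<and>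
     (\<forall>w x \<chi> \<eta> u y. closed_loop S A B P C Q F L Bc \<Phi> G K w x \<chi> \<eta> u y \<longrightarrow>
       (\<lambda>k. euclid_norm (y k)) \<longlonglongrightarrow> 0)"

end

theory Submission
  imports Defs "HOL-Analysis.L2_Norm"
begin

text \<open>
  The proof has two halves, stability without exosignal and regulation.

  Stability. Observability makes the plant state a linear function of the last \<open>l\<close> outputs and
  inputs and of the exosignal (\<open>state_linear_in_window\<close>), so that the data vector \<open>\<psi>\<close> obeys a recursion
  \<open>\<psi>(k + 1) = H (\<psi>(k), u(k), w(k))\<close> with an unknown matrix \<open>H\<close> (\<open>psi_next_linear\<close>). The experiment
  satisfies it, that is, \<open>\<Psi>1 = H (\<Psi>0, U1, W0)\<close>. The equality constraint of the program says that the
  combinations of samples in \<open>Y\<close> cancel the unknown exosignal, and with it the program becomes a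
  Lyapunov inequality for \<open>\<Theta> = H (I, K, 0)\<close> (\<open>sdp_closed_loop_powers_tendsto_0\<close>), whence
  \<open>\<Theta>\<^sup>k \<longlonglongrightarrow> 0\<close> (\<open>lmi_powers_tendsto_0\<close>). In the closed loop the controller state is a shift
  register that after \<open>l\<close> steps holds the last \<open>l\<close> outputs and inputs, so that \<open>(\<chi>, \<eta>)\<close> is the data
  vector of the closed-loop solution (\<open>closed_loop_state_eq_psi\<close>); without
  exosignal, \<open>(\<chi>, \<eta>)\<close> therefore evolves by \<open>\<Theta>\<close> from then on and drags the plant state along to zero
  (\<open>closed_loop_origin_gas\<close>).

  Regulation. Let \<open>q\<close> be the minimal polynomial of \<open>S\<close> and \<open>\<sigma>\<close> the time shift. Applying \<open>q(\<sigma>)\<close> to a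
  closed-loop solution gives a closed-loop solution again (\<open>closed_loop_poly_shift\<close>), and its
  exosignal is \<open>q(\<sigma>) w = q(S) w = 0\<close> (\<open>poly_shift_exosystem\<close>). By the first half, \<open>q(\<sigma>) \<eta>\<close> tends to
  zero. But the internal model is a realization of \<open>q(\<sigma>) \<eta>\<^sub>1 = y\<close> for the first block \<open>\<eta>\<^sub>1\<close> of \<open>\<eta>\<close>
  (\<open>internal_model_poly_shift\<close>), so that \<open>y\<close> tends to zero. This argument replaces the regulator
  equations: no steady-state solution is constructed.
\<close>

section \<open>Euclidean norm and matrix bounds\<close>

lemma euclid_norm_eq_L2_set: "euclid_norm v = L2_set (\<lambda>i. v $ i) {0..<dim_vec v}"
  by (simp add: euclid_norm_def L2_set_def scalar_prod_def power2_eq_square)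

lemma euclid_norm_nonneg: "0 \<le> euclid_norm v"
  by (simp add: euclid_norm_eq_L2_set L2_set_nonneg)

lemma abs_index_le_euclid_norm: "i < dim_vec v \<Longrightarrow> \<bar>v $ i\<bar> \<le> euclid_norm v"
proof -
  assume "i < dim_vec v"
  then have "\<bar>v $ i\<bar> \<le> L2_set (\<lambda>i. \<bar>v $ i\<bar>) {0..<dim_vec v}"
    by (intro member_le_L2_set) auto
  then show ?thesis by (simp add: euclid_norm_eq_L2_set L2_set_def)
qed

lemma euclid_norm_append_left_le: "euclid_norm a \<le> euclid_norm (a @\<^sub>v b)"
  and euclid_norm_append_right_le: "euclid_norm b \<le> euclid_norm (a @\<^sub>v b)"
  and euclid_norm_append_le: "euclid_norm (a @\<^sub>v b) \<le> euclid_norm a + euclid_norm b"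
proof -
  have *: "(a @\<^sub>v b) \<bullet> (a @\<^sub>v b) = a \<bullet> a + b \<bullet> b"
    by (rule scalar_prod_append[of _ "dim_vec a" _ "dim_vec b"]) auto
  have nonneg: "0 \<le> v \<bullet> v" for v :: "real vec"
    by (auto simp: scalar_prod_def intro: sum_nonneg)
  show "euclid_norm a \<le> euclid_norm (a @\<^sub>v b)" "euclid_norm b \<le> euclid_norm (a @\<^sub>v b)"
    using nonneg by (auto simp: euclid_norm_def *)
  show "euclid_norm (a @\<^sub>v b) \<le> euclid_norm a + euclid_norm b"
    unfolding euclid_norm_def * by (rule sqrt_add_le_add_sqrt) (use nonneg in auto)
qed

text \<open>
  An operator norm would serve as well; the entrywise sum is the bound that is obtained from
  entrywise convergence of matrix powers with finite sums alone.
\<close>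

definition entry_sum :: "real mat \<Rightarrow> real" where
  "entry_sum A = (\<Sum>i<dim_row A. \<Sum>j<dim_col A. \<bar>A $$ (i, j)\<bar>)"

lemma entry_sum_nonneg: "0 \<le> entry_sum A"
  by (auto simp: entry_sum_def intro!: sum_nonneg)

lemma euclid_norm_mult_mat_vec_le:
  assumes "v \<in> carrier_vec (dim_col A)"
  shows "euclid_norm (A *\<^sub>v v) \<le> entry_sum A * euclid_norm v"
proof -
  have "euclid_norm (A *\<^sub>v v) \<le> (\<Sum>i<dim_row A. \<bar>(A *\<^sub>v v) $ i\<bar>)"
    unfolding euclid_norm_eq_L2_set lessThan_atLeast0 dim_mult_mat_vec by (rule L2_set_le_sum_abs)
  also have "\<dots> \<le> (\<Sum>i<dim_row A. \<Sum>j<dim_col A. \<bar>A $$ (i, j)\<bar> * euclid_norm v)"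
  proof (rule sum_mono)
    fix i assume "i \<in> {..<dim_row A}"
    then have "(A *\<^sub>v v) $ i = (\<Sum>j<dim_col A. A $$ (i, j) * v $ j)"
      using assms by (auto simp: scalar_prod_def lessThan_atLeast0)
    also have "\<bar>\<dots>\<bar> \<le> (\<Sum>j<dim_col A. \<bar>A $$ (i, j)\<bar> * \<bar>v $ j\<bar>)"
      using sum_abs[of "\<lambda>j. A $$ (i, j) * v $ j" "{..<dim_col A}"] by (simp add: abs_mult)
    also have "\<dots> \<le> (\<Sum>j<dim_col A. \<bar>A $$ (i, j)\<bar> * euclid_norm v)"
      using assms by (intro sum_mono mult_left_mono abs_index_le_euclid_norm) auto
    finally show "\<bar>(A *\<^sub>v v) $ i\<bar> \<le> (\<Sum>j<dim_col A. \<bar>A $$ (i, j)\<bar> * euclid_norm v)" .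
  qed
  also have "\<dots> = entry_sum A * euclid_norm v"
    by (simp add: entry_sum_def sum_distrib_right)
  finally show ?thesis .
qed

section \<open>Quantities that depend linearly on a measured vector\<close>

text \<open>
  \<open>linear_fun_of D s g r f\<close> says that one matrix recovers \<open>f \<tau>\<close> from \<open>g \<tau>\<close> for every \<open>\<tau>\<close> in
  \<open>D\<close>. With \<open>D\<close> a set of pieces of trajectories, this expresses that a quantity is determined by
  other ones through the plant equations, without writing out the matrix that does it; the closure
  properties below replace block-matrix computations. That the matrix is common to all of \<open>D\<close> is the
  point: it makes the experiment and the closed loop share one matrix.
\<close>

definition linear_fun_of ::
  "'a set \<Rightarrow> nat \<Rightarrow> ('a \<Rightarrow> real vec) \<Rightarrow> nat \<Rightarrow> ('a \<Rightarrow> real vec) \<Rightarrow> bool" where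
  "linear_fun_of D s g r f \<longleftrightarrow>
     (\<exists>H \<in> carrier_mat r s. \<forall>\<tau>\<in>D. g \<tau> \<in> carrier_vec s \<and> f \<tau> = H *\<^sub>v g \<tau>)"

lemma linear_fun_of_refl:
  assumes "\<And>\<tau>. \<tau> \<in> D \<Longrightarrow> g \<tau> \<in> carrier_vec s"
  shows "linear_fun_of D s g s g"
  unfolding linear_fun_of_def by (rule bexI[of _ "1\<^sub>m s"]) (use assms in auto)

lemma linear_fun_of_cong:
  "linear_fun_of D s g r f \<Longrightarrow> (\<And>\<tau>. \<tau> \<in> D \<Longrightarrow> f' \<tau> = f \<tau>) \<Longrightarrow> linear_fun_of D s g r f'"
  by (auto simp: linear_fun_of_def)

lemma linear_fun_of_mult:
  assumes f: "linear_fun_of D s g r f" and M: "M \<in> carrier_mat r' r"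
  shows "linear_fun_of D s g r' (\<lambda>\<tau>. M *\<^sub>v f \<tau>)"
proof -
  obtain H where H: "H \<in> carrier_mat r s"
    and *: "\<And>\<tau>. \<tau> \<in> D \<Longrightarrow> g \<tau> \<in> carrier_vec s \<and> f \<tau> = H *\<^sub>v g \<tau>"
    using f by (auto simp: linear_fun_of_def)
  show ?thesis
    unfolding linear_fun_of_def
    by (rule bexI[of _ "M * H"]) (use * H M in \<open>auto intro: assoc_mult_mat_vec[symmetric]\<close>)
qed

lemma linear_fun_of_trans:
  assumes f: "linear_fun_of D s g r f" and h: "linear_fun_of D r f t h"
  shows "linear_fun_of D s g t h"
proof -
  obtain H where H: "H \<in> carrier_mat t r" "\<And>\<tau>. \<tau> \<in> D \<Longrightarrow> h \<tau> = H *\<^sub>v f \<tau>"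
    using h by (auto simp: linear_fun_of_def)
  show ?thesis
    by (rule linear_fun_of_cong[OF linear_fun_of_mult[OF f H(1)] H(2)])
qed

lemma linear_fun_of_add:
  assumes "linear_fun_of D s g r f" "linear_fun_of D s g r f'"
  shows "linear_fun_of D s g r (\<lambda>\<tau>. f \<tau> + f' \<tau>)"
proof -
  obtain H H' where H: "H \<in> carrier_mat r s" "H' \<in> carrier_mat r s"
    and *: "\<And>\<tau>. \<tau> \<in> D \<Longrightarrow> g \<tau> \<in> carrier_vec s \<and> f \<tau> = H *\<^sub>v g \<tau> \<and> f' \<tau> = H' *\<^sub>v g \<tau>"
    using assms unfolding linear_fun_of_def by metis
  show ?thesis
    unfolding linear_fun_of_def
    by (rule bexI[of _ "H + H'"])
      (use * H in \<open>auto intro: add_mult_distrib_mat_vec[symmetric]\<close>)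
qed

lemma linear_fun_of_diff:
  assumes "linear_fun_of D s g r f" "linear_fun_of D s g r f'"
  shows "linear_fun_of D s g r (\<lambda>\<tau>. f \<tau> - f' \<tau>)"
proof -
  obtain H H' where H: "H \<in> carrier_mat r s" "H' \<in> carrier_mat r s"
    and *: "\<And>\<tau>. \<tau> \<in> D \<Longrightarrow> g \<tau> \<in> carrier_vec s \<and> f \<tau> = H *\<^sub>v g \<tau> \<and> f' \<tau> = H' *\<^sub>v g \<tau>"
    using assms unfolding linear_fun_of_def by metis
  show ?thesis
    unfolding linear_fun_of_def
    by (rule bexI[of _ "H - H'"])
      (use * H in \<open>auto intro: minus_mult_distrib_mat_vec[symmetric]\<close>)
qed

lemma linear_fun_of_append:
  assumes "linear_fun_of D s g r f" "linear_fun_of D s g r' f'"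
  shows "linear_fun_of D s g (r + r') (\<lambda>\<tau>. f \<tau> @\<^sub>v f' \<tau>)"
proof -
  obtain H H' where H: "H \<in> carrier_mat r s" "H' \<in> carrier_mat r' s"
    and *: "\<And>\<tau>. \<tau> \<in> D \<Longrightarrow> g \<tau> \<in> carrier_vec s \<and> f \<tau> = H *\<^sub>v g \<tau> \<and> f' \<tau> = H' *\<^sub>v g \<tau>"
    using assms unfolding linear_fun_of_def by metis
  show ?thesis
    unfolding linear_fun_of_def
    by (rule bexI[of _ "H @\<^sub>r H'"])
      (use * H in \<open>auto intro: mat_mult_append[symmetric]\<close>)
qed

lemma linear_fun_of_zero:
  assumes "\<And>\<tau>. \<tau> \<in> D \<Longrightarrow> g \<tau> \<in> carrier_vec s"
  shows "linear_fun_of D s g r (\<lambda>\<tau>. 0\<^sub>v r)"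
  unfolding linear_fun_of_def by (rule bexI[of _ "0\<^sub>m r s"]) (use assms in auto)

lemma linear_fun_of_append_parts:
  assumes fh: "linear_fun_of D s g (r1 + r2) (\<lambda>\<tau>. f \<tau> @\<^sub>v h \<tau>)"
    and f: "\<And>\<tau>. \<tau> \<in> D \<Longrightarrow> f \<tau> \<in> carrier_vec r1" and h: "\<And>\<tau>. \<tau> \<in> D \<Longrightarrow> h \<tau> \<in> carrier_vec r2"
  shows "linear_fun_of D s g r1 f" "linear_fun_of D s g r2 h"
proof -
  \<comment> \<open>The two block rows of an identity matrix, each completed by blocks without rows so that
    the product rule for \<open>four_block_mat\<close> applies.\<close>
  let ?E = "four_block_mat (1\<^sub>m r1) (0\<^sub>m r1 r2) (0\<^sub>m 0 r1) (0\<^sub>m 0 r2) :: real mat"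
  let ?E' = "four_block_mat (0\<^sub>m 0 r1) (0\<^sub>m 0 r2) (0\<^sub>m r2 r1) (1\<^sub>m r2) :: real mat"
  have "f \<tau> = ?E *\<^sub>v (f \<tau> @\<^sub>v h \<tau>)" if "\<tau> \<in> D" for \<tau>
    by (subst four_block_mat_mult_vec[OF _ _ _ _ f[OF that] h[OF that], of _ r1 _ _ 0])
      (use f[OF that] h[OF that] in auto)
  moreover have "?E \<in> carrier_mat r1 (r1 + r2)"
    by (intro carrier_matI) auto
  ultimately show "linear_fun_of D s g r1 f"
    by (intro linear_fun_of_cong[OF linear_fun_of_mult[OF fh]])
  have "h \<tau> = ?E' *\<^sub>v (f \<tau> @\<^sub>v h \<tau>)" if "\<tau> \<in> D" for \<tau>
    by (subst four_block_mat_mult_vec[OF _ _ _ _ f[OF that] h[OF that], of _ 0 _ _ r2])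
      (use f[OF that] h[OF that] in auto)
  moreover have "?E' \<in> carrier_mat r2 (r1 + r2)"
    by (intro carrier_matI) auto
  ultimately show "linear_fun_of D s g r2 h"
    by (intro linear_fun_of_cong[OF linear_fun_of_mult[OF fh]])
qed

text \<open>
  Turns linear dependence into a norm bound. Asking for \<open>1 \<le> c\<close> lets the bound be iterated
  without sign considerations.
\<close>

lemma linear_fun_of_bounded:
  assumes "linear_fun_of D s g r f"
  obtains c where "1 \<le> c" "\<And>\<tau>. \<tau> \<in> D \<Longrightarrow> euclid_norm (f \<tau>) \<le> c * euclid_norm (g \<tau>)"
proof -
  obtain H where H: "H \<in> carrier_mat r s"
    and *: "\<And>\<tau>. \<tau> \<in> D \<Longrightarrow> g \<tau> \<in> carrier_vec s \<and> f \<tau> = H *\<^sub>v g \<tau>"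
    using assms by (auto simp: linear_fun_of_def)
  have "euclid_norm (f \<tau>) \<le> max 1 (entry_sum H) * euclid_norm (g \<tau>)" if "\<tau> \<in> D" for \<tau>
  proof -
    have "euclid_norm (f \<tau>) \<le> entry_sum H * euclid_norm (g \<tau>)"
      using euclid_norm_mult_mat_vec_le[of "g \<tau>" H] *[OF that] H by auto
    also have "\<dots> \<le> max 1 (entry_sum H) * euclid_norm (g \<tau>)"
      by (intro mult_right_mono euclid_norm_nonneg) auto
    finally show ?thesis .
  qed
  then show thesis using that[of "max 1 (entry_sum H)"] by auto
qed

section \<open>Stacked vectors and windows of past samples\<close>

lemma append_vec_assoc: "(a @\<^sub>v b) @\<^sub>v c = a @\<^sub>v (b @\<^sub>v c)"
  by (rule eq_vecI) auto

lemma append_vec_vNil_right [simp]: "a @\<^sub>v vNil = a"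
  by (rule eq_vecI) auto

lemma stack_vecs_simps [simp]:
  "stack_vecs [] = vNil" "stack_vecs (v # vs) = v @\<^sub>v stack_vecs vs"
  by (simp_all add: stack_vecs_def)

lemma stack_vecs_append: "stack_vecs (vs @ ws) = stack_vecs vs @\<^sub>v stack_vecs ws"
  by (induction vs) (simp_all add: append_vec_assoc)

lemma stack_vecs_carrier:
  "set vs \<subseteq> carrier_vec r \<Longrightarrow> stack_vecs vs \<in> carrier_vec (r * length vs)"
  by (induction vs) auto

lemma stack_vecs_index:
  "set vs \<subseteq> carrier_vec r \<Longrightarrow> i < length vs \<Longrightarrow> j < r \<Longrightarrow> stack_vecs vs $ (r * i + j) = (vs ! i) $ j"
proof (induction vs arbitrary: i)
  case (Cons v vs)
  have v: "dim_vec v = r" using Cons.prems(1) by auto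
  have dim: "dim_vec (stack_vecs vs) = r * length vs"
    using stack_vecs_carrier[of vs r] Cons.prems(1) by auto
  show ?case
  proof (cases i)
    case 0
    then show ?thesis using v Cons.prems(3) by simp
  next
    case (Suc i')
    then have i': "i' < length vs" using Cons.prems(2) by simp
    have "r * i' + j < r * Suc i'" using Cons.prems(3) by simp
    also have "\<dots> \<le> r * length vs" using i' by (intro mult_le_mono2) simp
    finally show ?thesis
      using Cons.IH[of i'] Cons.prems i' v dim
      unfolding Suc stack_vecs_simps by (subst index_append_vec(1)) (auto simp: algebra_simps)
  qed
qed simp

lemma linear_fun_of_stack:
  assumes g: "\<And>\<tau>. \<tau> \<in> D \<Longrightarrow> g \<tau> \<in> carrier_vec s"
    and "\<And>f. f \<in> set fs \<Longrightarrow> linear_fun_of D s g r f"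
  shows "linear_fun_of D s g (r * length fs) (\<lambda>\<tau>. stack_vecs (map (\<lambda>f. f \<tau>) fs))"
  using assms(2)
proof (induction fs)
  case Nil
  then show ?case using linear_fun_of_zero[OF g, where r = 0] by simp
next
  case (Cons f fs)
  then show ?case
    using linear_fun_of_append[of D s g r f "r * length fs"] by simp
qed

lemma linear_fun_of_stack_component:
  assumes "linear_fun_of D s g (r * length fs) (\<lambda>\<tau>. stack_vecs (map (\<lambda>f. f \<tau>) fs))"
    and "\<And>f \<tau>. f \<in> set fs \<Longrightarrow> \<tau> \<in> D \<Longrightarrow> f \<tau> \<in> carrier_vec r"
    and "f \<in> set fs"
  shows "linear_fun_of D s g r f"
  using assms
proof (induction fs)
  case (Cons h hs)
  have "linear_fun_of D s g (r + r * length hs) (\<lambda>\<tau>. h \<tau> @\<^sub>v stack_vecs (map (\<lambda>f. f \<tau>) hs))"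
    using Cons.prems(1) by simp
  moreover have "h \<tau> \<in> carrier_vec r" "stack_vecs (map (\<lambda>f. f \<tau>) hs) \<in> carrier_vec (r * length hs)"
    if "\<tau> \<in> D" for \<tau>
    using stack_vecs_carrier[of "map (\<lambda>f. f \<tau>) hs" r] Cons.prems(2) that by auto
  ultimately have "linear_fun_of D s g r h"
    "linear_fun_of D s g (r * length hs) (\<lambda>\<tau>. stack_vecs (map (\<lambda>f. f \<tau>) hs))"
    by - (rule linear_fun_of_append_parts; blast)+
  then show ?case
    using Cons.IH Cons.prems by auto
qed simp

definition past :: "nat \<Rightarrow> (nat \<Rightarrow> 'a :: zero vec) \<Rightarrow> nat \<Rightarrow> 'a vec" where
  "past l f k = stack_vecs (map f [k - l..<k])"

lemma psi_eq: "psi l y u \<eta> k = past l y k @\<^sub>v (past l u k @\<^sub>v \<eta> k)"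
  by (simp add: psi_def past_def stack_vecs_append)

lemma past_eq_map:
  assumes "l \<le> k"
  shows "past l f k = stack_vecs (map (\<lambda>j. f (k - l + j)) [0..<l])"
proof -
  have "[k - l..<k] = map (\<lambda>j. k - l + j) [0..<l]"
    using assms by (intro nth_equalityI) auto
  then show ?thesis by (simp add: past_def comp_def)
qed

lemma past_carrier:
  assumes "l \<le> k" "\<And>j. j < l \<Longrightarrow> f (k - l + j) \<in> carrier_vec r"
  shows "past l f k \<in> carrier_vec (r * l)"
  using stack_vecs_carrier[of "map (\<lambda>j. f (k - l + j)) [0..<l]" r] assms
  by (simp add: past_eq_map image_subset_iff)

lemma past_index:
  assumes "l \<le> k" "\<And>j. j < l \<Longrightarrow> f (k - l + j) \<in> carrier_vec r" "i < l" "j < r"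
  shows "past l f k $ (r * i + j) = f (k - l + i) $ j"
  using stack_vecs_index[of "map (\<lambda>j. f (k - l + j)) [0..<l]" r i j] assms
  by (simp add: past_eq_map image_subset_iff)

lemma linear_fun_of_past_component:
  fixes f :: "'a \<Rightarrow> nat \<Rightarrow> real vec" and k :: "'a \<Rightarrow> nat"
  assumes "linear_fun_of D s g (r * l) (\<lambda>\<tau>. past l (f \<tau>) (k \<tau>))"
    and "\<And>\<tau>. \<tau> \<in> D \<Longrightarrow> l \<le> k \<tau>"
    and "\<And>\<tau> j. \<tau> \<in> D \<Longrightarrow> j < l \<Longrightarrow> f \<tau> (k \<tau> - l + j) \<in> carrier_vec r"
    and "j < l"
  shows "linear_fun_of D s g r (\<lambda>\<tau>. f \<tau> (k \<tau> - l + j))"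
proof (rule linear_fun_of_stack_component)
  let ?fs = "map (\<lambda>j \<tau>. f \<tau> (k \<tau> - l + j)) [0..<l]"
  show "linear_fun_of D s g (r * length ?fs) (\<lambda>\<tau>. stack_vecs (map (\<lambda>f. f \<tau>) ?fs))"
    using assms(1,2) by (auto simp: comp_def past_eq_map elim!: linear_fun_of_cong)
  show "(\<lambda>\<tau>. f \<tau> (k \<tau> - l + j)) \<in> set ?fs" using \<open>j < l\<close> by auto
qed (use assms in auto)

section \<open>Observability\<close>

lemma full_column_rank_left_inverse:
  fixes M :: "real mat"
  assumes M: "M \<in> carrier_mat r n" and rank: "vec_space.rank r M = n"
  obtains L where "L \<in> carrier_mat n r" "L * M = 1\<^sub>m n"
proof -
  interpret vec_space "TYPE(real)" r .
  \<comment> \<open>The rank counts columns as a set, so repeated columns have to be excluded separately.\<close>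
  have distinct: "distinct (cols M)"
  proof -
    obtain V where V: "maximal V (\<lambda>T. T \<subseteq> set (cols M) \<and> lin_indpt T)"
      using maximal_exists[of "(\<lambda>T. T \<subseteq> set (cols M) \<and> lin_indpt T)" "card (set (cols M))" "{}"]
      by (meson List.finite_set card_mono empty_iff empty_subsetI finite_lin_indpt2
          rev_finite_subset)
    then have "n = card V" using rank_card_indpt[OF M] rank by simp
    also have "\<dots> \<le> card (set (cols M))"
      using V by (intro card_mono) (auto simp: maximal_def)
    finally have "card (set (cols M)) = length (cols M)"
      using M card_length[of "cols M"] by auto
    then show ?thesis by (rule card_distinct)
  qed
  have inj: "v = 0\<^sub>v n" if "v \<in> carrier_vec n" "M *\<^sub>v v = 0\<^sub>v r" for v
    using lin_depI[OF M that(1) _ that(2) distinct] full_rank_lin_indpt[OF M rank distinct] by blast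
  let ?G = "transpose_mat M * M"
  have G: "?G \<in> carrier_mat n n" using M by auto
  have "det ?G \<noteq> 0"
  proof
    assume "det ?G = 0"
    then obtain v where v: "v \<in> carrier_vec n" "v \<noteq> 0\<^sub>v n" "?G *\<^sub>v v = 0\<^sub>v n"
      using det_0_iff_vec_prod_zero[OF G] by auto
    \<comment> \<open>The Gram matrix has the same kernel as \<open>M\<close>: its quadratic form is \<open>|M v|\<^sup>2\<close>.\<close>
    have "(M *\<^sub>v v) \<bullet> (M *\<^sub>v v) = (transpose_mat M *\<^sub>v (M *\<^sub>v v)) \<bullet> v"
      by (rule transpose_vec_mult_scalar[OF M v(1) mult_mat_vec_carrier[OF M v(1)], symmetric])
    also have "\<dots> = (?G *\<^sub>v v) \<bullet> v"
      using M v(1) by simp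
    also have "\<dots> = 0" unfolding v(3) using v(1) by simp
    finally have "M *\<^sub>v v = 0\<^sub>v r"
      using M by (intro eq_vecI) (auto simp: scalar_prod_def sum_nonneg_eq_0_iff)
    then show False using inj v by auto
  qed
  then obtain I where I: "I \<in> carrier_mat n n" "I * ?G = 1\<^sub>m n"
    using det_non_zero_imp_unit[OF G, of "()"] by (auto simp: Units_def ring_mat_def)
  show thesis
  proof (rule that)
    show "I * transpose_mat M \<in> carrier_mat n r" using I M by auto
    show "(I * transpose_mat M) * M = 1\<^sub>m n"
      using I M by (simp add: assoc_mult_mat[of _ n n _ r _ n])
  qed
qed

lemma foldr_append_rows_carrier_mult:
  assumes "set Ms \<subseteq> carrier_mat r n" "v \<in> carrier_vec n"
  shows "foldr append_rows Ms (0\<^sub>m 0 n) \<in> carrier_mat (r * length Ms) n \<and>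
    foldr append_rows Ms (0\<^sub>m 0 n) *\<^sub>v v = stack_vecs (map (\<lambda>M. M *\<^sub>v v) Ms)"
  using assms(1)
proof (induction Ms)
  case Nil
  have "0\<^sub>m 0 n *\<^sub>v v = 0\<^sub>v 0" by (rule eq_vecI) auto
  then show ?case by simp
next
  case (Cons M Ms)
  then have M: "M \<in> carrier_mat r n"
    and IH: "foldr append_rows Ms (0\<^sub>m 0 n) \<in> carrier_mat (r * length Ms) n"
      "foldr append_rows Ms (0\<^sub>m 0 n) *\<^sub>v v = stack_vecs (map (\<lambda>M. M *\<^sub>v v) Ms)"
    by auto
  show ?case
    using carrier_append_rows[OF M IH(1)] mat_mult_append[OF M IH(1) assms(2)] IH(2)
    by simp
qed

lemma observability_mat_carrier:
  assumes "A \<in> carrier_mat n n" "C \<in> carrier_mat p n"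
  shows "observability_mat A C l \<in> carrier_mat (p * l) n"
  using foldr_append_rows_carrier_mult[of "map (\<lambda>k. C * (A ^\<^sub>m k)) [0..<l]" p n "0\<^sub>v n"] assms
  by (simp add: observability_mat_def image_subset_iff)

lemma observability_mat_mult:
  assumes "A \<in> carrier_mat n n" "C \<in> carrier_mat p n" "v \<in> carrier_vec n"
  shows "observability_mat A C l *\<^sub>v v = stack_vecs (map (\<lambda>k. (C * (A ^\<^sub>m k)) *\<^sub>v v) [0..<l])"
proof -
  have "set (map (\<lambda>k. C * (A ^\<^sub>m k)) [0..<l]) \<subseteq> carrier_mat p n"
    using assms by auto
  from foldr_append_rows_carrier_mult[OF this assms(3)] show ?thesis
    using assms by (auto simp: observability_mat_def comp_def)
qed

lemma observability_index_rank:
  assumes A: "A \<in> carrier_mat n n" and C: "C \<in> carrier_mat p n" and "observable A C"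
  shows "1 \<le> observability_index A C \<and> observability_rank A C (observability_index A C) = n"
proof -
  have "\<exists>l. 1 \<le> l \<and> observability_rank A C l = dim_row A"
  proof (cases "n = 0")
    case True
    have "observability_mat A C 1 \<in> carrier_mat (p * 1) n"
      by (rule observability_mat_carrier[OF A C])
    from vec_space.rank_le_nc[OF this] show ?thesis
      using True A C by (intro exI[of _ 1]) (auto simp: observability_rank_def)
  next
    case False
    then show ?thesis
      using assms by (intro exI[of _ n]) (auto simp: observable_def)
  qed
  from LeastI_ex[OF this] show ?thesis
    using A by (simp add: observability_index_def)
qed

section \<open>Reconstruction of the plant state from past inputs and outputs\<close>

lemma pow_mat_Suc_left:
  assumes A: "(A :: 'a :: semiring_1 mat) \<in> carrier_mat n n"
  shows "A ^\<^sub>m Suc j = A * A ^\<^sub>m j"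
proof (induction j)
  case (Suc j)
  have "A ^\<^sub>m Suc (Suc j) = (A * A ^\<^sub>m j) * A"
    using Suc by simp
  also have "\<dots> = A * (A ^\<^sub>m j * A)"
    using A by (intro assoc_mult_mat) auto
  finally show ?case by simp
qed (use A in simp)

text \<open>
  Over a window of length \<open>l\<close>, every \<open>w j\<close> is determined by the last one because \<open>S\<close> is
  invertible, and \<open>x j\<close> is the free response \<open>A\<^sup>j x 0\<close> plus a forced response that is linear
  in the inputs and the exosignal. Subtracting the forced response from the outputs leaves the vector
  \<open>(C x 0, C A x 0, \<dots>)\<close>, from which a left inverse of the observability matrix gives \<open>x 0\<close>, and
  hence \<open>x l\<close>. The family index \<open>\<tau>\<close> keeps the resulting matrix independent of the trajectory and of
  the position \<open>k \<tau>\<close> of the window.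
\<close>

lemma state_linear_in_window:
  fixes w x u y :: "'a \<Rightarrow> nat \<Rightarrow> real vec" and k :: "'a \<Rightarrow> nat"
  assumes S: "S \<in> carrier_mat nw nw" and A: "A \<in> carrier_mat n n" and B: "B \<in> carrier_mat n m"
    and P: "P \<in> carrier_mat n nw" and C: "C \<in> carrier_mat p n" and Q: "Q \<in> carrier_mat p nw"
    and rank: "observability_rank A C l = n" and det: "det S \<noteq> 0"
    and D: "\<And>\<tau>. \<tau> \<in> D \<Longrightarrow> l \<le> k \<tau> \<and> plant_traj {k \<tau> - l..<k \<tau>} S A B P C Q (w \<tau>) (x \<tau>) (u \<tau>) (y \<tau>)"
    and w: "\<And>\<tau>. \<tau> \<in> D \<Longrightarrow> w \<tau> (k \<tau>) \<in> carrier_vec nw"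
    and x: "\<And>\<tau>. \<tau> \<in> D \<Longrightarrow> x \<tau> (k \<tau>) \<in> carrier_vec n"
  shows "linear_fun_of D (p * l + (m * l + nw))
           (\<lambda>\<tau>. past l (y \<tau>) (k \<tau>) @\<^sub>v (past l (u \<tau>) (k \<tau>) @\<^sub>v w \<tau> (k \<tau>))) n (\<lambda>\<tau>. x \<tau> (k \<tau>))"
proof -
  define s where "s = p * l + (m * l + nw)"
  define g where "g = (\<lambda>\<tau>. past l (y \<tau>) (k \<tau>) @\<^sub>v (past l (u \<tau>) (k \<tau>) @\<^sub>v w \<tau> (k \<tau>)))"
  define W where "W = (\<lambda>j \<tau>. w \<tau> (k \<tau> - l + j))"
  define X where "X = (\<lambda>j \<tau>. x \<tau> (k \<tau> - l + j))"
  define U where "U = (\<lambda>j \<tau>. u \<tau> (k \<tau> - l + j))"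
  define Y where "Y = (\<lambda>j \<tau>. y \<tau> (k \<tau> - l + j))"
  have step: "W j \<tau> \<in> carrier_vec nw" "X j \<tau> \<in> carrier_vec n" "U j \<tau> \<in> carrier_vec m"
    "W (Suc j) \<tau> = S *\<^sub>v W j \<tau>" "X (Suc j) \<tau> = A *\<^sub>v X j \<tau> + B *\<^sub>v U j \<tau> + P *\<^sub>v W j \<tau>"
    "Y j \<tau> = C *\<^sub>v X j \<tau> + Q *\<^sub>v W j \<tau>" "Y j \<tau> \<in> carrier_vec p"
    if "\<tau> \<in> D" "j < l" for j \<tau>
  proof -
    have "k \<tau> - l + j \<in> {k \<tau> - l..<k \<tau>}" using D[OF that(1)] that(2) by auto
    then show "W j \<tau> \<in> carrier_vec nw" "X j \<tau> \<in> carrier_vec n" "U j \<tau> \<in> carrier_vec m"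
    "W (Suc j) \<tau> = S *\<^sub>v W j \<tau>" "X (Suc j) \<tau> = A *\<^sub>v X j \<tau> + B *\<^sub>v U j \<tau> + P *\<^sub>v W j \<tau>"
    "Y j \<tau> = C *\<^sub>v X j \<tau> + Q *\<^sub>v W j \<tau>"
      using D[OF that(1)] S A B unfolding plant_traj_def W_def X_def U_def Y_def
      by (simp_all)
    then show "Y j \<tau> \<in> carrier_vec p" using C Q by auto
  qed
  note Wstep = step(4)
  have last: "W l \<tau> = w \<tau> (k \<tau>)" "X l \<tau> = x \<tau> (k \<tau>)" if "\<tau> \<in> D" for \<tau>
    using D[OF that] by (simp_all add: W_def X_def)
  have Wc: "W j \<tau> \<in> carrier_vec nw" and Xc: "X j \<tau> \<in> carrier_vec n" if "\<tau> \<in> D" "j \<le> l" for j \<tau>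
    using step[OF that(1)] last[OF that(1)] w x that by (cases "j = l"; auto)+
  have pasts: "past l (y \<tau>) (k \<tau>) \<in> carrier_vec (p * l)" "past l (u \<tau>) (k \<tau>) \<in> carrier_vec (m * l)"
    if "\<tau> \<in> D" for \<tau>
    using D[OF that] step[OF that] by (auto intro!: past_carrier simp: Y_def U_def)
  have g: "g \<tau> \<in> carrier_vec s" if "\<tau> \<in> D" for \<tau>
    using pasts[OF that] w[OF that] by (auto simp: g_def s_def)
  note refl = linear_fun_of_refl[of D g s, OF g]
  have 1: "linear_fun_of D s g (p * l) (\<lambda>\<tau>. past l (y \<tau>) (k \<tau>))"
    "linear_fun_of D s g (m * l + nw) (\<lambda>\<tau>. past l (u \<tau>) (k \<tau>) @\<^sub>v w \<tau> (k \<tau>))"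
    using refl pasts w
    by (auto simp: g_def s_def intro: linear_fun_of_append_parts)
  have 2: "linear_fun_of D s g (m * l) (\<lambda>\<tau>. past l (u \<tau>) (k \<tau>))"
    "linear_fun_of D s g nw (\<lambda>\<tau>. w \<tau> (k \<tau>))"
    using pasts w by (auto intro: linear_fun_of_append_parts[OF 1(2)])
  have linY: "linear_fun_of D s g p (Y j)" and linU: "linear_fun_of D s g m (U j)" if "j < l" for j
    using linear_fun_of_past_component[OF 1(1) _ _ that] linear_fun_of_past_component[OF 2(1) _ _ that]
      D step by (auto simp: Y_def U_def)
  obtain Si where Si: "Si \<in> carrier_mat nw nw" "Si * S = 1\<^sub>m nw"
    using det_non_zero_imp_unit[OF S det, of "()"] by (auto simp: Units_def ring_mat_def)
  \<comment> \<open>The exosignal in the window is recovered backwards in time from its last value.\<close>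
  have linW: "linear_fun_of D s g nw (W j)" if "j \<le> l" for j
    using that
  proof (induction rule: inc_induct)
    case base
    then show ?case using 2(2) last(1) by (auto elim!: linear_fun_of_cong)
  next
    case (step j)
    have "W j \<tau> = Si *\<^sub>v W (Suc j) \<tau>" if "\<tau> \<in> D" for \<tau>
    proof -
      have Wj: "W j \<tau> \<in> carrier_vec nw" using Wc[OF that] step(2) by simp
      have "Si *\<^sub>v W (Suc j) \<tau> = (Si * S) *\<^sub>v W j \<tau>"
        using Wstep[OF that step(2)] assoc_mult_mat_vec[OF Si(1) S Wj] by simp
      then show ?thesis using Wj unfolding Si(2) by simp
    qed
    then show ?case by (rule linear_fun_of_cong[OF linear_fun_of_mult[OF step(3) Si(1)]])
  qed
  \<comment> \<open>The forced response, that is, the state minus the free response.\<close>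
  have linR: "linear_fun_of D s g n (\<lambda>\<tau>. X j \<tau> - (A ^\<^sub>m j) *\<^sub>v X 0 \<tau>)" if "j \<le> l" for j
    using that
  proof (induction j)
    case 0
    have "X 0 \<tau> - (A ^\<^sub>m 0) *\<^sub>v X 0 \<tau> = 0\<^sub>v n" if "\<tau> \<in> D" for \<tau>
      using Xc[OF that, of 0] A by simp
    then show ?case by (intro linear_fun_of_cong[OF linear_fun_of_zero[OF g]])
  next
    case (Suc j)
    let ?r = "\<lambda>\<tau>. A *\<^sub>v (X j \<tau> - (A ^\<^sub>m j) *\<^sub>v X 0 \<tau>) + B *\<^sub>v U j \<tau> + P *\<^sub>v W j \<tau>"
    have "linear_fun_of D s g n ?r"
      using Suc linU linW A B P by (intro linear_fun_of_add linear_fun_of_mult) auto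
    moreover have "X (Suc j) \<tau> - (A ^\<^sub>m Suc j) *\<^sub>v X 0 \<tau> = ?r \<tau>" if "\<tau> \<in> D" for \<tau>
    proof -
      have *: "X 0 \<tau> \<in> carrier_vec n" "X j \<tau> \<in> carrier_vec n" "U j \<tau> \<in> carrier_vec m" "W j \<tau> \<in> carrier_vec nw"
        using Xc that step[OF that, of j] Suc.prems by auto
      have Aj: "A ^\<^sub>m j \<in> carrier_mat n n" using A by simp
      have AjX: "(A ^\<^sub>m j) *\<^sub>v X 0 \<tau> \<in> carrier_vec n"
        using Aj *(1) by (rule mult_mat_vec_carrier)
      have "(A ^\<^sub>m Suc j) = A * A ^\<^sub>m j" using A by (rule pow_mat_Suc_left)
      then have free: "(A ^\<^sub>m Suc j) *\<^sub>v X 0 \<tau> = A *\<^sub>v ((A ^\<^sub>m j) *\<^sub>v X 0 \<tau>)"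
        using assoc_mult_mat_vec[OF A Aj *(1)] by (simp del: pow_mat.simps)
      moreover have "A *\<^sub>v (X j \<tau> - (A ^\<^sub>m j) *\<^sub>v X 0 \<tau>) = A *\<^sub>v X j \<tau> - A *\<^sub>v ((A ^\<^sub>m j) *\<^sub>v X 0 \<tau>)"
        using A AjX * by (intro mult_minus_distrib_mat_vec) auto
      moreover have "X (Suc j) \<tau> = A *\<^sub>v X j \<tau> + B *\<^sub>v U j \<tau> + P *\<^sub>v W j \<tau>"
        using step[OF that, of j] Suc.prems by auto
      ultimately show ?thesis
        unfolding free using A B P AjX * by (intro eq_vecI) auto
    qed
    ultimately show ?case by (rule linear_fun_of_cong)
  qed
  have linF: "linear_fun_of D s g p (\<lambda>\<tau>. (C * A ^\<^sub>m j) *\<^sub>v X 0 \<tau>)" if j: "j < l" for j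
  proof -
    let ?r = "\<lambda>\<tau>. Y j \<tau> - Q *\<^sub>v W j \<tau> - C *\<^sub>v (X j \<tau> - (A ^\<^sub>m j) *\<^sub>v X 0 \<tau>)"
    have "linear_fun_of D s g p ?r"
      using j linY linW C Q
      by (intro linear_fun_of_diff[OF _ linear_fun_of_mult[OF linR]]
          linear_fun_of_diff linear_fun_of_mult) auto
    moreover have "(C * A ^\<^sub>m j) *\<^sub>v X 0 \<tau> = ?r \<tau>" if "\<tau> \<in> D" for \<tau>
    proof -
      have *: "X 0 \<tau> \<in> carrier_vec n" "X j \<tau> \<in> carrier_vec n" "W j \<tau> \<in> carrier_vec nw"
        using Xc that step[OF that, of j] j by auto
      have Aj: "A ^\<^sub>m j \<in> carrier_mat n n" using A by simp
      have AjX: "(A ^\<^sub>m j) *\<^sub>v X 0 \<tau> \<in> carrier_vec n"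
        using Aj *(1) by (rule mult_mat_vec_carrier)
      have "C *\<^sub>v (X j \<tau> - (A ^\<^sub>m j) *\<^sub>v X 0 \<tau>) = C *\<^sub>v X j \<tau> - C *\<^sub>v ((A ^\<^sub>m j) *\<^sub>v X 0 \<tau>)"
        using C AjX * by (intro mult_minus_distrib_mat_vec) auto
      moreover have "(C * A ^\<^sub>m j) *\<^sub>v X 0 \<tau> = C *\<^sub>v ((A ^\<^sub>m j) *\<^sub>v X 0 \<tau>)"
        using C Aj * by simp
      ultimately show ?thesis
        using C Q Aj * step(6)[OF that j] by (intro eq_vecI) auto
    qed
    ultimately show ?thesis by (rule linear_fun_of_cong)
  qed
  let ?O = "observability_mat A C l"
  have "linear_fun_of D s g (p * l) (\<lambda>\<tau>. ?O *\<^sub>v X 0 \<tau>)"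
  proof -
    let ?fs = "map (\<lambda>j \<tau>. (C * A ^\<^sub>m j) *\<^sub>v X 0 \<tau>) [0..<l]"
    have "linear_fun_of D s g (p * length ?fs) (\<lambda>\<tau>. stack_vecs (map (\<lambda>f. f \<tau>) ?fs))"
      using linF by (intro linear_fun_of_stack g) auto
    then show ?thesis
      using observability_mat_mult[OF A C] Xc by (auto simp: comp_def elim!: linear_fun_of_cong)
  qed
  moreover obtain L where L: "L \<in> carrier_mat n (p * l)" "L * ?O = 1\<^sub>m n"
    using full_column_rank_left_inverse[OF observability_mat_carrier[OF A C, of l]] rank C
    unfolding observability_rank_def by auto
  ultimately have "linear_fun_of D s g n (\<lambda>\<tau>. L *\<^sub>v (?O *\<^sub>v X 0 \<tau>))"
    using linear_fun_of_mult by blast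
  moreover have "X 0 \<tau> = L *\<^sub>v (?O *\<^sub>v X 0 \<tau>)" if "\<tau> \<in> D" for \<tau>
    using assoc_mult_mat_vec[OF L(1) observability_mat_carrier[OF A C, of l] Xc[OF that, of 0]] L Xc[OF that, of 0]
    by simp
  ultimately have "linear_fun_of D s g n (X 0)"
    by (rule linear_fun_of_cong)
  then have "linear_fun_of D s g n (\<lambda>\<tau>. (X l \<tau> - (A ^\<^sub>m l) *\<^sub>v X 0 \<tau>) + (A ^\<^sub>m l) *\<^sub>v X 0 \<tau>)"
    using A by (intro linear_fun_of_add linR linear_fun_of_mult[of _ _ _ n]) auto
  moreover have "x \<tau> (k \<tau>) = (X l \<tau> - (A ^\<^sub>m l) *\<^sub>v X 0 \<tau>) + (A ^\<^sub>m l) *\<^sub>v X 0 \<tau>" if "\<tau> \<in> D" for \<tau>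
    using Xc[OF that, of l] Xc[OF that, of 0] A last[OF that] by (intro eq_vecI) auto
  ultimately show ?thesis
    unfolding s_def g_def by (rule linear_fun_of_cong)
qed

section \<open>The linear matrix inequality implies stability\<close>

lemma mult_mat_vec_uminus:
  fixes M :: "real mat"
  assumes "M \<in> carrier_mat r c" "v \<in> carrier_vec c"
  shows "M *\<^sub>v (- v) = - (M *\<^sub>v v)"
  using assms by (intro eq_vecI) auto

lemma uminus_scalar_prod_diff:
  fixes a b c :: "real vec"
  assumes "a \<in> carrier_vec N" "b \<in> carrier_vec N" "c \<in> carrier_vec N"
  shows "(- a) \<bullet> (b + - c) = a \<bullet> c - a \<bullet> b"
  using assms scalar_prod_add_distrib[of "- a" N b "- c"] by simp

text \<open>
  Evaluating the block form at \<open>(v, - \<Theta>\<^sup>T v)\<close> eliminates the second component as in a Schur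
  complement, without inverting \<open>X\<close>.
\<close>

lemma lmi_quadratic_form_decreases:
  fixes X \<Theta> :: "real mat"
  assumes X: "X \<in> carrier_mat N N" and \<Theta>: "\<Theta> \<in> carrier_mat N N"
    and lmi: "pos_def (four_block_mat X (\<Theta> * X) (transpose_mat (\<Theta> * X)) X)"
    and v: "v \<in> carrier_vec N" "v \<noteq> 0\<^sub>v N"
  shows "(transpose_mat \<Theta> *\<^sub>v v) \<bullet> (X *\<^sub>v (transpose_mat \<Theta> *\<^sub>v v)) < v \<bullet> (X *\<^sub>v v)"
proof -
  let ?t = "transpose_mat \<Theta> *\<^sub>v v"
  let ?M = "four_block_mat X (\<Theta> * X) (transpose_mat (\<Theta> * X)) X"
  have t: "?t \<in> carrier_vec N" using \<Theta> v by auto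
  have Xt: "X *\<^sub>v ?t \<in> carrier_vec N" using X t by (rule mult_mat_vec_carrier)
  have Xv: "X *\<^sub>v v \<in> carrier_vec N" using X v(1) by (rule mult_mat_vec_carrier)
  have TX: "\<Theta> * X \<in> carrier_mat N N" using X \<Theta> by auto
  have TXt: "(\<Theta> * X) *\<^sub>v ?t \<in> carrier_vec N" using TX t by (rule mult_mat_vec_carrier)
  have TTv: "transpose_mat (\<Theta> * X) *\<^sub>v v \<in> carrier_vec N"
    using TX v(1) by (intro mult_mat_vec_carrier[of _ N N]) auto
  have "v @\<^sub>v (- ?t) \<noteq> 0\<^sub>v (N + N)"
  proof
    assume eq: "v @\<^sub>v (- ?t) = 0\<^sub>v (N + N)"
    have "v $ i = 0" if "i < N" for i
      using arg_cong[OF eq, of "\<lambda>z. z $ i"] that v by simp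
    then show False using v by (auto intro: eq_vecI)
  qed
  moreover have "v @\<^sub>v (- ?t) \<in> carrier_vec (dim_row ?M)" "dim_row ?M = N + N"
    using v t X by auto
  ultimately have "0 < (v @\<^sub>v (- ?t)) \<bullet> (?M *\<^sub>v (v @\<^sub>v (- ?t)))"
    using lmi unfolding pos_def_def by metis
  also have "?M *\<^sub>v (v @\<^sub>v (- ?t)) =
      (X *\<^sub>v v + (\<Theta> * X) *\<^sub>v (- ?t)) @\<^sub>v (transpose_mat (\<Theta> * X) *\<^sub>v v + X *\<^sub>v (- ?t))"
    by (rule four_block_mat_mult_vec[OF X TX _ X v(1)]) (use TX t in auto)
  also have "(\<Theta> * X) *\<^sub>v (- ?t) = - ((\<Theta> * X) *\<^sub>v ?t)"
    by (rule mult_mat_vec_uminus[OF TX t])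
  also have "X *\<^sub>v (- ?t) = - (X *\<^sub>v ?t)"
    by (rule mult_mat_vec_uminus[OF X t])
  also have "(v @\<^sub>v - ?t) \<bullet> ((X *\<^sub>v v + - ((\<Theta> * X) *\<^sub>v ?t)) @\<^sub>v
        (transpose_mat (\<Theta> * X) *\<^sub>v v + - (X *\<^sub>v ?t))) =
      v \<bullet> (X *\<^sub>v v + - ((\<Theta> * X) *\<^sub>v ?t)) + (- ?t) \<bullet> (transpose_mat (\<Theta> * X) *\<^sub>v v + - (X *\<^sub>v ?t))"
    by (rule scalar_prod_append[of _ N _ N]) (use v t Xv TXt TTv Xt in auto)
  also have "v \<bullet> (X *\<^sub>v v + - ((\<Theta> * X) *\<^sub>v ?t)) = v \<bullet> (X *\<^sub>v v) - v \<bullet> ((\<Theta> * X) *\<^sub>v ?t)"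
    using scalar_prod_add_distrib[OF v(1) Xv, of "- ((\<Theta> * X) *\<^sub>v ?t)"] v(1) TXt \<Theta> by simp
  also have "(- ?t) \<bullet> (transpose_mat (\<Theta> * X) *\<^sub>v v + - (X *\<^sub>v ?t)) =
      ?t \<bullet> (X *\<^sub>v ?t) - ?t \<bullet> (transpose_mat (\<Theta> * X) *\<^sub>v v)"
    by (rule uminus_scalar_prod_diff[OF t TTv Xt])
  also have "v \<bullet> ((\<Theta> * X) *\<^sub>v ?t) = ?t \<bullet> (X *\<^sub>v ?t)"
    using transpose_vec_mult_scalar[OF \<Theta> Xt v(1)] assoc_mult_mat_vec[OF \<Theta> X t] by simp
  also have "?t \<bullet> (transpose_mat (\<Theta> * X) *\<^sub>v v) = ?t \<bullet> (X *\<^sub>v ?t)"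
    using transpose_vec_mult_scalar[OF TX t v(1)] transpose_vec_mult_scalar[OF \<Theta> Xt v(1)]
      assoc_mult_mat_vec[OF \<Theta> X t] comm_scalar_prod[OF t TTv] by simp
  finally show ?thesis by simp
qed

lemma pos_def_det_nonzero:
  assumes D: "D \<in> carrier_mat N N" and "pos_def D"
  shows "det D \<noteq> 0"
proof
  assume "det D = 0"
  then obtain v where v: "v \<in> carrier_vec N" "v \<noteq> 0\<^sub>v N" "D *\<^sub>v v = 0\<^sub>v N"
    using det_0_iff_vec_prod_zero[OF D] by auto
  then have "0 < v \<bullet> (D *\<^sub>v v)" using assms by (auto simp: pos_def_def)
  then show False unfolding v(3) using v(1) by simp
qed

lemma pos_def_form_nonneg:
  assumes D: "D \<in> carrier_mat N N" and "pos_def D" and v: "v \<in> carrier_vec N"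
  shows "0 \<le> v \<bullet> (D *\<^sub>v v)"
proof (cases "v = 0\<^sub>v N")
  case True
  then show ?thesis using mult_mat_vec_carrier[OF D v] by simp
next
  case False
  then show ?thesis using assms by (auto simp: pos_def_def)
qed

text \<open>
  A coercivity statement for positive definite forms: the coordinate \<open>v $ i\<close> is the inner product,
  in the geometry of \<open>D\<close>, of \<open>v\<close> with \<open>D\<^sup>-\<^sup>1 e\<^sub>i\<close>, so that the Cauchy-Schwarz inequality applies.
\<close>

lemma pos_def_form_bounds_coordinate:
  assumes D: "D \<in> carrier_mat N N" and pd: "pos_def D" and i: "i < N"
  obtains c where "\<And>v. v \<in> carrier_vec N \<Longrightarrow> (v $ i)\<^sup>2 \<le> c * (v \<bullet> (D *\<^sub>v v))"
proof -
  obtain I where I: "I \<in> carrier_mat N N" "D * I = 1\<^sub>m N"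
    using det_non_zero_imp_unit[OF D pos_def_det_nonzero[OF D pd], of "()"]
    by (auto simp: Units_def ring_mat_def)
  define f where "f = I *\<^sub>v unit_vec N i"
  have f: "f \<in> carrier_vec N" using I by (auto simp: f_def)
  have Df: "D *\<^sub>v f = unit_vec N i"
    using assoc_mult_mat_vec[OF D I(1), of "unit_vec N i"] I by (simp add: f_def)
  have sym: "transpose_mat D = D" using pd by (simp add: pos_def_def)
  have "f \<noteq> 0\<^sub>v N"
  proof
    assume f0: "f = 0\<^sub>v N"
    have "D *\<^sub>v f = 0\<^sub>v N"
      unfolding f0 using D by (intro eq_vecI) auto
    then have "unit_vec N i $ i = (0\<^sub>v N :: real vec) $ i" using Df by simp
    then show False using i by simp
  qed
  then have "0 < f \<bullet> (D *\<^sub>v f)"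
    using pd f D by (auto simp: pos_def_def)
  then have c: "0 < f $ i" using f i unfolding Df by simp
  have "(v $ i)\<^sup>2 \<le> f $ i * (v \<bullet> (D *\<^sub>v v))" if v: "v \<in> carrier_vec N" for v
  proof -
    \<comment> \<open>The discriminant argument, with the minimizing \<open>t\<close> for the form at \<open>v - t f\<close>.\<close>
    define t where "t = v $ i / f $ i"
    have Dv: "D *\<^sub>v v \<in> carrier_vec N" using D v by (rule mult_mat_vec_carrier)
    have "0 \<le> (v - t \<cdot>\<^sub>v f) \<bullet> (D *\<^sub>v (v - t \<cdot>\<^sub>v f))"
      using v f by (intro pos_def_form_nonneg[OF D pd]) auto
    also have "D *\<^sub>v (v - t \<cdot>\<^sub>v f) = D *\<^sub>v v - t \<cdot>\<^sub>v unit_vec N i"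
      using mult_minus_distrib_mat_vec[OF D v, of "t \<cdot>\<^sub>v f"] mult_mat_vec[OF D f, of t] f Df by simp
    also have "(v - t \<cdot>\<^sub>v f) \<bullet> (D *\<^sub>v v - t \<cdot>\<^sub>v unit_vec N i) =
        v \<bullet> (D *\<^sub>v v) - t * (v \<bullet> unit_vec N i) - t * (f \<bullet> (D *\<^sub>v v)) + t * t * (f \<bullet> unit_vec N i)"
    proof -
      have "(v - t \<cdot>\<^sub>v f) \<bullet> (D *\<^sub>v v - t \<cdot>\<^sub>v unit_vec N i) =
          v \<bullet> (D *\<^sub>v v - t \<cdot>\<^sub>v unit_vec N i) - (t \<cdot>\<^sub>v f) \<bullet> (D *\<^sub>v v - t \<cdot>\<^sub>v unit_vec N i)"
        by (rule minus_scalar_prod_distrib[of _ N]) (use v f Dv in auto)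
      also have "v \<bullet> (D *\<^sub>v v - t \<cdot>\<^sub>v unit_vec N i) = v \<bullet> (D *\<^sub>v v) - v \<bullet> (t \<cdot>\<^sub>v unit_vec N i)"
        by (rule scalar_prod_minus_distrib[of _ N]) (use v f Dv in auto)
      also have "(t \<cdot>\<^sub>v f) \<bullet> (D *\<^sub>v v - t \<cdot>\<^sub>v unit_vec N i) =
          (t \<cdot>\<^sub>v f) \<bullet> (D *\<^sub>v v) - (t \<cdot>\<^sub>v f) \<bullet> (t \<cdot>\<^sub>v unit_vec N i)"
        by (rule scalar_prod_minus_distrib[of _ N]) (use v f Dv in auto)
      finally show ?thesis using v f Dv i by (simp add: algebra_simps)
    qed
    also have "f \<bullet> (D *\<^sub>v v) = v $ i"
      using transpose_vec_mult_scalar[OF D v f] v i Df sym by simp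
    also have "v \<bullet> unit_vec N i = v $ i" using v i by simp
    also have "f \<bullet> unit_vec N i = f $ i" using f i by simp
    finally have "0 \<le> v \<bullet> (D *\<^sub>v v) - (v $ i)\<^sup>2 / f $ i"
      using c by (simp add: t_def power2_eq_square field_simps)
    then show ?thesis using c by (simp add: field_simps)
  qed
  then show thesis by (rule that)
qed

lemma transpose_pow_mat:
  assumes M: "(M :: real mat) \<in> carrier_mat N N"
  shows "transpose_mat (M ^\<^sub>m k) = transpose_mat M ^\<^sub>m k"
proof (induction k)
  case (Suc k)
  have "transpose_mat (M ^\<^sub>m Suc k) = transpose_mat M * transpose_mat (M ^\<^sub>m k)"
    using M by (simp add: transpose_mult[of _ N N _ N])
  also have "\<dots> = transpose_mat M ^\<^sub>m Suc k"
    using M Suc by (subst pow_mat_Suc_left[of _ N]) auto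
  finally show ?case .
qed (use M in simp)

text \<open>
  Along \<open>v (k + 1) = \<Theta>\<^sup>T v k\<close> the form of \<open>X\<close> is nonincreasing and bounded below, hence convergent;
  its decrements are the values of the form of \<open>D\<close>, which therefore tend to zero and force every
  coordinate of \<open>v k\<close> to zero. Starting at the unit vectors gives the rows of the powers of \<open>\<Theta>\<close>.
\<close>

lemma lyapunov_powers_tendsto_0:
  fixes \<Theta> X D :: "real mat"
  assumes \<Theta>: "\<Theta> \<in> carrier_mat N N" and X: "X \<in> carrier_mat N N" "pos_def X"
    and D: "D \<in> carrier_mat N N" "pos_def D"
    and dec: "\<And>v. v \<in> carrier_vec N \<Longrightarrow>
      (transpose_mat \<Theta> *\<^sub>v v) \<bullet> (X *\<^sub>v (transpose_mat \<Theta> *\<^sub>v v)) = v \<bullet> (X *\<^sub>v v) - v \<bullet> (D *\<^sub>v v)"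
    and i: "i < N" and j: "j < N"
  shows "(\<lambda>k. (\<Theta> ^\<^sub>m k) $$ (i, j)) \<longlonglongrightarrow> 0"
proof -
  define v where "v = (\<lambda>k. (transpose_mat \<Theta> ^\<^sub>m k) *\<^sub>v unit_vec N i)"
  have T: "transpose_mat \<Theta> \<in> carrier_mat N N" using \<Theta> by simp
  have Tk: "transpose_mat \<Theta> ^\<^sub>m k \<in> carrier_mat N N" for k using T by simp
  have v: "v k \<in> carrier_vec N" for k
    unfolding v_def using Tk by (intro mult_mat_vec_carrier) auto
  have v_Suc: "v (Suc k) = transpose_mat \<Theta> *\<^sub>v v k" for k
    unfolding v_def pow_mat_Suc_left[OF T] by (rule assoc_mult_mat_vec[OF T Tk]) auto
  define V where "V = (\<lambda>k. v k \<bullet> (X *\<^sub>v v k))"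
  have V_Suc: "V (Suc k) = V k - v k \<bullet> (D *\<^sub>v v k)" for k
    using dec[OF v[of k]] by (simp add: V_def v_Suc)
  have "decseq V"
    using pos_def_form_nonneg[OF D v] V_Suc by (auto simp: decseq_Suc_iff)
  moreover have "0 \<le> V k" for k
    unfolding V_def by (rule pos_def_form_nonneg[OF X v])
  ultimately obtain L where L: "V \<longlonglongrightarrow> L"
    using decseq_convergent[of V 0] by blast
  have "(\<lambda>k. V k - V (Suc k)) \<longlonglongrightarrow> L - L"
    by (intro tendsto_diff L LIMSEQ_Suc)
  then have lim: "(\<lambda>k. v k \<bullet> (D *\<^sub>v v k)) \<longlonglongrightarrow> 0"
    by (simp add: V_Suc)
  obtain c where c: "\<And>v. v \<in> carrier_vec N \<Longrightarrow> (v $ j)\<^sup>2 \<le> c * (v \<bullet> (D *\<^sub>v v))"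
    using pos_def_form_bounds_coordinate[OF D j] by blast
  have "(\<lambda>k. (v k $ j)\<^sup>2) \<longlonglongrightarrow> 0"
  proof (rule tendsto_sandwich[of "\<lambda>_. 0"])
    show "(\<lambda>k. c * (v k \<bullet> (D *\<^sub>v v k))) \<longlonglongrightarrow> 0"
      using tendsto_mult_left[OF lim, of c] by simp
    show "\<forall>\<^sub>F k in sequentially. (v k $ j)\<^sup>2 \<le> c * (v k \<bullet> (D *\<^sub>v v k))"
      using c[OF v] by simp
  qed auto
  then have "(\<lambda>k. v k $ j) \<longlonglongrightarrow> 0"
    using tendsto_real_sqrt[of "\<lambda>k. (v k $ j)\<^sup>2" 0] by (simp add: tendsto_rabs_zero_iff)
  moreover have "v k $ j = (\<Theta> ^\<^sub>m k) $$ (i, j)" for k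
  proof -
    define M where "M = transpose_mat (\<Theta> ^\<^sub>m k)"
    have M: "M \<in> carrier_mat N N" using Tk[of k] by (simp add: M_def transpose_pow_mat[OF \<Theta>])
    have "v k $ j = M $$ (j, i)"
      unfolding v_def transpose_pow_mat[OF \<Theta>, symmetric] M_def[symmetric]
      using M i j by simp
    then have "v k $ j = (transpose_mat (\<Theta> ^\<^sub>m k)) $$ (j, i)" by (simp add: M_def)
    then show ?thesis using \<Theta> i j by simp
  qed
  ultimately show ?thesis by simp
qed

text \<open>
  The decrement of the form of \<open>X\<close> along \<open>\<Theta>\<^sup>T\<close> is the form of \<open>X - \<Theta> X \<Theta>\<^sup>T\<close>, which the
  inequality makes positive definite.
\<close>

lemma lmi_powers_tendsto_0:
  fixes X \<Theta> :: "real mat"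
  assumes X: "X \<in> carrier_mat N N" "pos_def X" and \<Theta>: "\<Theta> \<in> carrier_mat N N"
    and lmi: "pos_def (four_block_mat X (\<Theta> * X) (transpose_mat (\<Theta> * X)) X)"
  shows "(\<lambda>k. entry_sum (\<Theta> ^\<^sub>m k)) \<longlonglongrightarrow> 0"
proof -
  let ?D = "X - \<Theta> * X * transpose_mat \<Theta>"
  have T: "transpose_mat \<Theta> \<in> carrier_mat N N" using \<Theta> by simp
  have TX: "\<Theta> * X \<in> carrier_mat N N" using \<Theta> X by simp
  have TXT: "\<Theta> * X * transpose_mat \<Theta> \<in> carrier_mat N N" using TX T by simp
  have D: "?D \<in> carrier_mat N N" using TXT by (rule minus_carrier_mat)
  have form: "v \<bullet> (?D *\<^sub>v v) =
      v \<bullet> (X *\<^sub>v v) - (transpose_mat \<Theta> *\<^sub>v v) \<bullet> (X *\<^sub>v (transpose_mat \<Theta> *\<^sub>v v))"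
    if v: "v \<in> carrier_vec N" for v
  proof -
    let ?t = "transpose_mat \<Theta> *\<^sub>v v"
    have t: "?t \<in> carrier_vec N" using T v by (rule mult_mat_vec_carrier)
    have Xt: "X *\<^sub>v ?t \<in> carrier_vec N" using X(1) t by (rule mult_mat_vec_carrier)
    have "?D *\<^sub>v v = X *\<^sub>v v - (\<Theta> * X * transpose_mat \<Theta>) *\<^sub>v v"
      by (rule minus_mult_distrib_mat_vec[OF X(1) TXT v])
    also have "(\<Theta> * X * transpose_mat \<Theta>) *\<^sub>v v = \<Theta> *\<^sub>v (X *\<^sub>v ?t)"
      using assoc_mult_mat_vec[OF TX T v] assoc_mult_mat_vec[OF \<Theta> X(1) t] by simp
    also have "v \<bullet> (X *\<^sub>v v - \<Theta> *\<^sub>v (X *\<^sub>v ?t)) = v \<bullet> (X *\<^sub>v v) - v \<bullet> (\<Theta> *\<^sub>v (X *\<^sub>v ?t))"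
      by (rule scalar_prod_minus_distrib[OF v mult_mat_vec_carrier[OF X(1) v]
            mult_mat_vec_carrier[OF \<Theta> Xt]])
    also have "v \<bullet> (\<Theta> *\<^sub>v (X *\<^sub>v ?t)) = ?t \<bullet> (X *\<^sub>v ?t)"
      by (rule transpose_vec_mult_scalar[OF \<Theta> Xt v, symmetric])
    finally show ?thesis .
  qed
  have "pos_def ?D"
    unfolding pos_def_def
  proof (intro conjI ballI impI)
    show "square_mat ?D" using D by auto
    have sym: "transpose_mat X = X" using X by (simp add: pos_def_def)
    have "transpose_mat (\<Theta> * X * transpose_mat \<Theta>) = \<Theta> * X * transpose_mat \<Theta>"
      using transpose_mult[OF TX T] transpose_mult[OF \<Theta> X(1)] assoc_mult_mat[OF \<Theta> X(1) T] sym
      by simp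
    then show "transpose_mat ?D = ?D"
      using transpose_minus[OF X(1) TXT] sym by simp
    fix v :: "real vec" assume "v \<in> carrier_vec (dim_row ?D)" "v \<noteq> 0\<^sub>v (dim_row ?D)"
    then have v: "v \<in> carrier_vec N" "v \<noteq> 0\<^sub>v N" using D by auto
    show "0 < v \<bullet> (?D *\<^sub>v v)"
      using lmi_quadratic_form_decreases[OF X(1) \<Theta> lmi v] form[OF v(1)] by simp
  qed
  then have "(\<lambda>k. (\<Theta> ^\<^sub>m k) $$ (i, j)) \<longlonglongrightarrow> 0" if "i < N" "j < N" for i j
    using lyapunov_powers_tendsto_0[OF \<Theta> X D _ _ that] form by simp
  then have "(\<lambda>k. \<Sum>i<N. \<Sum>j<N. \<bar>(\<Theta> ^\<^sub>m k) $$ (i, j)\<bar>) \<longlonglongrightarrow> (\<Sum>i<N. \<Sum>j<N. 0)"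
    by (intro tendsto_sum tendsto_rabs_zero) auto
  moreover have "entry_sum (\<Theta> ^\<^sub>m k) = (\<Sum>i<N. \<Sum>j<N. \<bar>(\<Theta> ^\<^sub>m k) $$ (i, j)\<bar>)" for k
    using pow_carrier_mat[OF \<Theta>, of k] unfolding entry_sum_def by (simp only: carrier_matD)
  ultimately show ?thesis by simp
qed

section \<open>The controller as a shift register\<close>

text \<open>
  The injection of a vector into the last of \<open>l\<close> blocks of size \<open>r\<close>. It is the nonzero part of all
  three input matrices of the controller.
\<close>

definition last_block :: "nat \<Rightarrow> nat \<Rightarrow> real mat" where
  "last_block r l = mat (r * l) r (\<lambda>(i, j). if i = r * (l - 1) + j then 1 else 0)"

lemma block_index_less: "i < l \<Longrightarrow> j < r \<Longrightarrow> r * i + j < r * (l :: nat)"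
proof -
  assume "i < l" "j < r"
  then have "r * i + j < r * Suc i" by simp
  also have "\<dots> \<le> r * l" using \<open>i < l\<close> by (intro mult_le_mono2) simp
  finally show ?thesis .
qed

lemma block_index_cases:
  assumes "k < r * (l :: nat)"
  obtains i j where "i < l" "j < r" "k = r * i + j"
proof
  have "0 < r" using assms by (cases r) auto
  then show "k mod r < r" by simp
  show "k div r < l" using assms \<open>0 < r\<close> by (simp add: less_mult_imp_div_less mult.commute)
  show "k = r * (k div r) + k mod r" by simp
qed

lemma block_vec_eqI:
  assumes "a \<in> carrier_vec (r * l)" "b \<in> carrier_vec (r * l)"
    and "\<And>i j. i < l \<Longrightarrow> j < r \<Longrightarrow> a $ (r * i + j) = b $ (r * i + j)"
  shows "a = b"
proof (rule eq_vecI)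
  fix k assume "k < dim_vec b"
  then have "k < r * l" using assms(2) by simp
  then show "a $ k = b $ k" by (rule block_index_cases) (use assms(3) in auto)
qed (use assms in auto)

lemma last_block_carrier: "last_block r l \<in> carrier_mat (r * l) r"
  by (simp add: last_block_def)

lemma block_shift_carrier: "(block_shift r l :: real mat) \<in> carrier_mat (r * l) (r * l)"
  by (simp add: block_shift_def)

lemma last_block_mult_index:
  assumes v: "v \<in> carrier_vec r" and i: "i < l" and j: "j < r"
  shows "(last_block r l *\<^sub>v v) $ (r * i + j) = (if Suc i = l then v $ j else 0)"
proof -
  have less: "r * i + j < r * l" using i j by (rule block_index_less)
  have eq: "r * i + j = r * (l - 1) + j' \<longleftrightarrow> Suc i = l \<and> j' = j" if "j' < r" for j'
  proof
    assume *: "r * i + j = r * (l - 1) + j'"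
    have "i = (r * i + j) div r" using j by simp
    also have "\<dots> = l - 1" unfolding * using that by simp
    finally show "Suc i = l \<and> j' = j" using i * by auto
  qed auto
  have "(last_block r l *\<^sub>v v) $ (r * i + j) =
      (\<Sum>j'\<in>{0..<r}. (if r * i + j = r * (l - 1) + j' then 1 else 0) * v $ j')"
    using v less by (simp add: last_block_def scalar_prod_def)
  also have "\<dots> = (\<Sum>j'\<in>{0..<r}. if j' = j then (if Suc i = l then v $ j else 0) else 0)"
  proof (rule sum.cong[OF refl])
    fix x assume "x \<in> {0..<r}"
    then show "(if r * i + j = r * (l - 1) + x then 1 else 0) * v $ x =
        (if x = j then (if Suc i = l then v $ j else 0) else 0)"
      using eq[of x] by (cases "r * i + j = r * (l - 1) + x") auto
  qed
  also have "\<dots> = (if Suc i = l then v $ j else 0)" using j by simp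
  finally show ?thesis .
qed

lemma block_shift_mult_index:
  fixes v :: "real vec"
  assumes v: "v \<in> carrier_vec (r * l)" and i: "i < l" and j: "j < r"
  shows "(block_shift r l *\<^sub>v v) $ (r * i + j) = (if Suc i < l then v $ (r * Suc i + j) else 0)"
proof -
  have less: "r * i + j < r * l" using i j by (rule block_index_less)
  have "(block_shift r l *\<^sub>v v) $ (r * i + j) =
      (\<Sum>k\<in>{0..<r * l}. (if k = r * i + j + r then 1 else 0) * v $ k)"
    using v less by (simp add: block_shift_def scalar_prod_def)
  also have "\<dots> = (\<Sum>k\<in>{0..<r * l}. if k = r * Suc i + j then v $ (r * Suc i + j) else 0)"
    by (intro sum.cong) (auto simp: algebra_simps)
  also have "\<dots> = (if r * Suc i + j < r * l then v $ (r * Suc i + j) else 0)" by simp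
  also have "r * Suc i + j < r * l \<longleftrightarrow> Suc i < l"
  proof
    assume "r * Suc i + j < r * l"
    then have "r * Suc i < r * l" by simp
    then show "Suc i < l" by (simp only: mult_less_cancel1)
  qed (rule block_index_less[OF _ j])
  finally show ?thesis .
qed

text \<open>
  One step of a shift register: the oldest block of \<open>a\<close> is dropped and \<open>v\<close> is appended.
\<close>

definition shift_in :: "nat \<Rightarrow> nat \<Rightarrow> real vec \<Rightarrow> real vec \<Rightarrow> real vec" where
  "shift_in r l a v = block_shift r l *\<^sub>v a + last_block r l *\<^sub>v v"

lemma shift_in_carrier: "shift_in r l a v \<in> carrier_vec (r * l)"
  by (rule carrier_vecI) (simp add: shift_in_def last_block_def)

lemma shift_in_index:
  assumes "a \<in> carrier_vec (r * l)" "v \<in> carrier_vec r" "i < l" "j < r"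
  shows "shift_in r l a v $ (r * i + j) = (if Suc i < l then a $ (r * Suc i + j) else v $ j)"
  using assms block_index_less[OF assms(3,4)]
    last_block_mult_index[OF assms(2-4)] block_shift_mult_index[OF assms(1,3,4)]
  by (auto simp: shift_in_def last_block_def)

lemma past_Suc:
  fixes f :: "nat \<Rightarrow> real vec"
  assumes "l \<le> k" and f: "\<And>i. k - l \<le> i \<Longrightarrow> i \<le> k \<Longrightarrow> f i \<in> carrier_vec r"
  shows "past l f (Suc k) = shift_in r l (past l f k) (f k)"
proof (rule block_vec_eqI)
  have past: "past l f k \<in> carrier_vec (r * l)"
    using assms by (intro past_carrier) auto
  show "past l f (Suc k) \<in> carrier_vec (r * l)"
    using assms by (intro past_carrier) auto
  fix i j assume ij: "i < l" "j < r"
  have "past l f (Suc k) $ (r * i + j) = f (Suc k - l + i) $ j"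
    using assms ij by (intro past_index) auto
  moreover have "past l f k $ (r * Suc i + j) = f (k - l + Suc i) $ j" if "Suc i < l"
    using assms ij that by (intro past_index) auto
  moreover have "k - l + Suc i = Suc k - l + i" "Suc i = l \<Longrightarrow> Suc k - l + i = k"
    using assms(1) by auto
  ultimately show "past l f (Suc k) $ (r * i + j) = shift_in r l (past l f k) (f k) $ (r * i + j)"
    using shift_in_index[OF past f[of k] ij] assms(1) ij by (cases "Suc i < l") auto
qed (rule shift_in_carrier)

text \<open>
  After \<open>l\<close> steps the initial content of the register is flushed. The intermediate statement follows
  one sample on its way through the register: at time \<open>k\<close>, block \<open>i\<close> holds the sample of time
  \<open>k + i - l\<close> as soon as \<open>l \<le> k + i\<close>.
\<close>

lemma shift_register_eq_past:
  assumes a: "\<And>k. a k \<in> carrier_vec (r * l)" and f: "\<And>k. f k \<in> carrier_vec r"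
    and step: "\<And>k. a (Suc k) = shift_in r l (a k) (f k)" and "l \<le> k"
  shows "a k = past l f k"
proof -
  have *: "a k $ (r * i + j) = f (k + i - l) $ j" if "l \<le> k + i" "i < l" "j < r" for k i j
    using that
  proof (induction k arbitrary: i)
    case (Suc k)
    have "Suc (k + i) - l = k" if "\<not> Suc i < l" using that Suc.prems(2) by simp
    then show ?case
      using Suc shift_in_index[OF a f Suc.prems(2,3), of k k] Suc.IH[of "Suc i"]
      by (cases "Suc i < l") (auto simp: step not_less)
  qed simp
  show ?thesis
    using assms by (intro block_vec_eqI[OF a]) (auto intro: past_carrier simp: * past_index)
qed

lemma ctrl_carrier:
  "(ctrl_F p m l :: real mat) \<in> carrier_mat (p * l + m * l) (p * l + m * l)"
  "(ctrl_L p m l :: real mat) \<in> carrier_mat (p * l + m * l) p"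
  "(ctrl_B p m l :: real mat) \<in> carrier_mat (p * l + m * l) m"
  by (auto simp: ctrl_F_def ctrl_L_def ctrl_B_def block_shift_def add_mult_distrib)

lemma ctrl_update:
  assumes a: "a \<in> carrier_vec (p * l)" and b: "b \<in> carrier_vec (m * l)"
    and y: "y \<in> carrier_vec p" and u: "u \<in> carrier_vec m" and l: "1 \<le> l"
  shows "ctrl_F p m l *\<^sub>v (a @\<^sub>v b) + ctrl_L p m l *\<^sub>v y + ctrl_B p m l *\<^sub>v u =
    shift_in p l a y @\<^sub>v shift_in m l b u"
proof -
  have "p * l = p * (l - 1) + p" using l by (cases l) auto
  then have pl: "p * (l - 1) + j < p * l" if "j < p" for j using that by simp
  have "ctrl_F p m l *\<^sub>v (a @\<^sub>v b) = block_shift p l *\<^sub>v a @\<^sub>v block_shift m l *\<^sub>v b"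
    unfolding ctrl_F_def by (rule mult_mat_vec_split[OF block_shift_carrier block_shift_carrier a b])
  moreover have "ctrl_L p m l *\<^sub>v y = (last_block p l *\<^sub>v y) @\<^sub>v 0\<^sub>v (m * l)"
  proof (rule eq_vecI)
    fix i assume "i < dim_vec ((last_block p l *\<^sub>v y) @\<^sub>v 0\<^sub>v (m * l))"
    then have i: "i < p * l + m * l" by (simp add: last_block_def)
    have "(ctrl_L p m l *\<^sub>v y) $ i =
        (\<Sum>j\<in>{0..<p}. (if i = p * (l - 1) + j then 1 else 0) * y $ j)"
      using i y by (simp add: ctrl_L_def scalar_prod_def add_mult_distrib)
    also have "\<dots> = ((last_block p l *\<^sub>v y) @\<^sub>v 0\<^sub>v (m * l)) $ i"
    proof (cases "i < p * l")
      case True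
      then show ?thesis using y by (simp add: last_block_def scalar_prod_def)
    next
      case False
      then have "(\<Sum>j\<in>{0..<p}. (if i = p * (l - 1) + j then 1 else 0) * y $ j) = 0"
        using pl by (intro sum.neutral) auto
      then show ?thesis using False i by (simp add: last_block_def)
    qed
    finally show "(ctrl_L p m l *\<^sub>v y) $ i = ((last_block p l *\<^sub>v y) @\<^sub>v 0\<^sub>v (m * l)) $ i" .
  qed (simp add: ctrl_L_def last_block_def add_mult_distrib)
  moreover have "ctrl_B p m l *\<^sub>v u = 0\<^sub>v (p * l) @\<^sub>v (last_block m l *\<^sub>v u)"
  proof (rule eq_vecI)
    fix i assume "i < dim_vec (0\<^sub>v (p * l) @\<^sub>v (last_block m l *\<^sub>v u))"
    then have i: "i < p * l + m * l" by (simp add: last_block_def)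
    have "(ctrl_B p m l *\<^sub>v u) $ i =
        (\<Sum>j\<in>{0..<m}. (if i = p * l + m * (l - 1) + j then 1 else 0) * u $ j)"
      using i u by (simp add: ctrl_B_def scalar_prod_def add_mult_distrib)
    also have "\<dots> = (0\<^sub>v (p * l) @\<^sub>v (last_block m l *\<^sub>v u)) $ i"
    proof (cases "i < p * l")
      case True
      then show ?thesis by (auto simp: last_block_def intro: sum.neutral)
    next
      case False
      then obtain i' where "i = p * l + i'" "i' < m * l" using i by (metis add_less_cancel_left le_Suc_ex not_less)
      then show ?thesis using u by (simp add: last_block_def scalar_prod_def)
    qed
    finally show "(ctrl_B p m l *\<^sub>v u) $ i = (0\<^sub>v (p * l) @\<^sub>v (last_block m l *\<^sub>v u)) $ i" .
  qed (simp add: ctrl_B_def last_block_def add_mult_distrib)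
  ultimately show ?thesis
    using a b y u
    by (intro eq_vecI) (auto simp: shift_in_def last_block_def block_shift_def)
qed

section \<open>The internal model\<close>

lemma im_carrier:
  "im_Phi p q \<in> carrier_mat (p * degree q) (p * degree q)" "im_G p d \<in> carrier_mat (p * d) p"
  by (simp_all add: im_Phi_def im_G_def Let_def)

lemma im_G_eq: "im_G p d = last_block p d"
  by (simp add: im_G_def last_block_def)

lemma im_Phi_mult_index:
  fixes v :: "real vec"
  assumes v: "v \<in> carrier_vec (p * degree q)" and i: "i < degree q" and j: "j < p"
  shows "(im_Phi p q *\<^sub>v v) $ (p * i + j) =
    (if Suc i < degree q then v $ (p * Suc i + j)
     else - (\<Sum>t<degree q. coeff q t * v $ (p * t + j)))"
proof -
  let ?d = "degree q"
  have less: "p * i + j < p * ?d" using i j by (rule block_index_less)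
  have div: "(p * i + j) div p = i" "(p * i + j) mod p = j" using j by auto
  show ?thesis
  proof (cases "Suc i < ?d")
    case True
    have less': "p * Suc i + j < p * ?d" using True j by (rule block_index_less)
    have "i \<noteq> ?d - Suc 0" using True by simp
    then have "(im_Phi p q *\<^sub>v v) $ (p * i + j) =
        (\<Sum>k\<in>{0..<p * ?d}. (if k = p * i + j + p then 1 else 0) * v $ k)"
      using v less True by (simp add: im_Phi_def Let_def scalar_prod_def div)
    also have "\<dots> = (\<Sum>k\<in>{0..<p * ?d}. if k = p * Suc i + j then v $ (p * Suc i + j) else 0)"
      by (intro sum.cong) (auto simp: algebra_simps)
    also have "\<dots> = v $ (p * Suc i + j)" using less' by simp
    finally show ?thesis using True by simp
  next
    case False
    then have last: "?d - Suc 0 = i" using i by simp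
    have "(im_Phi p q *\<^sub>v v) $ (p * i + j) =
        (\<Sum>k\<in>{0..<p * ?d}. (if j = k mod p then - coeff q (k div p) else 0) * v $ k)"
      using v less by (simp add: im_Phi_def Let_def scalar_prod_def div last j)
    also have "\<dots> = (\<Sum>k<?d * p. (if j = k mod p then - coeff q (k div p) else 0) * v $ k)"
      by (simp add: lessThan_atLeast0 mult.commute)
    also have "\<dots> = (\<Sum>t<?d. \<Sum>k\<in>{t * p..<t * p + p}.
        (if j = k mod p then - coeff q (k div p) else 0) * v $ k)"
      by (rule sum.nat_group[symmetric])
    also have "\<dots> = (\<Sum>t<?d. - coeff q t * v $ (p * t + j))"
    proof (rule sum.cong[OF refl])
      fix t assume "t \<in> {..<?d}"
      have "(if j = k mod p then - coeff q (k div p) else 0) * v $ k =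
          (if k = p * t + j then - coeff q t * v $ (p * t + j) else 0)"
        if k: "k \<in> {t * p..<t * p + p}" for k
      proof -
        obtain e where e: "k = p * t + e" "e < p"
          using k by (metis atLeastLessThan_iff le_Suc_ex mult.commute nat_add_left_cancel_less)
        then show ?thesis by auto
      qed
      then have "(\<Sum>k\<in>{t * p..<t * p + p}. (if j = k mod p then - coeff q (k div p) else 0) * v $ k) =
          (\<Sum>k\<in>{t * p..<t * p + p}. if k = p * t + j then - coeff q t * v $ (p * t + j) else 0)"
        by (intro sum.cong) auto
      also have "\<dots> = - coeff q t * v $ (p * t + j)"
        using j by (simp add: mult.commute)
      finally show "(\<Sum>k\<in>{t * p..<t * p + p}. (if j = k mod p then - coeff q (k div p) else 0) * v $ k) =
          - coeff q t * v $ (p * t + j)" .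
    qed
    finally show ?thesis using False by (simp add: sum_negf)
  qed
qed

section \<open>Applying a polynomial in the time shift\<close>

text \<open>
  \<open>poly_shift q f\<close> is \<open>q(\<sigma>) f\<close>, where \<open>\<sigma>\<close> is the shift \<open>(\<sigma> f) k = f (k + 1)\<close>. Since \<open>q(\<sigma>)\<close>
  commutes with constant matrices and with \<open>\<sigma>\<close>, it maps solutions of linear time-invariant equations
  to solutions.
\<close>

definition poly_shift :: "real poly \<Rightarrow> (nat \<Rightarrow> real vec) \<Rightarrow> nat \<Rightarrow> real vec" where
  "poly_shift q f k = vec (dim_vec (f k)) (\<lambda>j. \<Sum>i\<le>degree q. coeff q i * f (k + i) $ j)"

lemma poly_shift_carrier: "f k \<in> carrier_vec r \<Longrightarrow> poly_shift q f k \<in> carrier_vec r"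
  by (simp add: poly_shift_def)

lemma poly_shift_mult:
  assumes M: "M \<in> carrier_mat r c" and f: "\<And>k. f k \<in> carrier_vec c"
  shows "poly_shift q (\<lambda>k. M *\<^sub>v f k) k = M *\<^sub>v poly_shift q f k"
proof (rule eq_vecI)
  have dim: "dim_vec (f k) = c" for k using f[of k] by simp
  fix j assume "j < dim_vec (M *\<^sub>v poly_shift q f k)"
  then have j: "j < r" using M by simp
  have "poly_shift q (\<lambda>k. M *\<^sub>v f k) k $ j =
      (\<Sum>i\<le>degree q. coeff q i * (\<Sum>t\<in>{0..<c}. M $$ (j, t) * f (k + i) $ t))"
    using M j dim by (simp add: poly_shift_def scalar_prod_def)
  also have "\<dots> = (\<Sum>t\<in>{0..<c}. M $$ (j, t) * (\<Sum>i\<le>degree q. coeff q i * f (k + i) $ t))"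
    by (simp add: sum_distrib_left sum.swap[of _ "{0..<c}"] mult.left_commute)
  also have "\<dots> = (M *\<^sub>v poly_shift q f k) $ j"
    using M j dim by (simp add: poly_shift_def scalar_prod_def)
  finally show "poly_shift q (\<lambda>k. M *\<^sub>v f k) k $ j = (M *\<^sub>v poly_shift q f k) $ j" .
qed (simp add: poly_shift_def)

lemma poly_shift_add:
  assumes "\<And>k. f k \<in> carrier_vec r" "\<And>k. g k \<in> carrier_vec r"
  shows "poly_shift q (\<lambda>k. f k + g k) k = poly_shift q f k + poly_shift q g k"
proof -
  have "dim_vec (f k) = r" "dim_vec (g k) = r" for k using assms[of k] by auto
  then show ?thesis
    by (intro eq_vecI) (simp_all add: poly_shift_def distrib_left sum.distrib)
qed

lemma poly_shift_append:
  assumes "\<And>k. f k \<in> carrier_vec r" "\<And>k. g k \<in> carrier_vec r'"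
  shows "poly_shift q (\<lambda>k. f k @\<^sub>v g k) k = poly_shift q f k @\<^sub>v poly_shift q g k"
proof -
  have "dim_vec (f k) = r" "dim_vec (g k) = r'" for k using assms[of k] by auto
  then show ?thesis
    by (intro eq_vecI) (simp_all add: poly_shift_def)
qed

lemma poly_shift_Suc: "poly_shift q f (Suc k) = poly_shift q (\<lambda>k. f (Suc k)) k"
  by (simp add: poly_shift_def)

lemma poly_shift_exosystem:
  assumes S: "S \<in> carrier_mat nw nw" and w: "\<And>k. w k \<in> carrier_vec nw"
    and step: "\<And>k. w (Suc k) = S *\<^sub>v w k"
  shows "poly_shift q w k = poly_mat q S *\<^sub>v w k"
proof (rule eq_vecI)
  have dim: "dim_vec (w k) = nw" for k using w[of k] by simp
  have pow: "w (k + i) = (S ^\<^sub>m i) *\<^sub>v w k" for i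
  proof (induction i)
    case 0
    then show ?case using S w by simp
  next
    case (Suc i)
    have "S ^\<^sub>m i \<in> carrier_mat nw nw" using S by simp
    then show ?case
      using Suc step[of "k + i"] assoc_mult_mat_vec[OF S _ w] unfolding pow_mat_Suc_left[OF S] by simp
  qed
  fix j assume "j < dim_vec (poly_mat q S *\<^sub>v w k)"
  then have j: "j < nw" using S by (simp add: poly_mat_def)
  have "poly_shift q w k $ j =
      (\<Sum>i\<le>degree q. coeff q i * (\<Sum>t\<in>{0..<nw}. (S ^\<^sub>m i) $$ (j, t) * w k $ t))"
  proof -
    have "(M *\<^sub>v w k) $ j = (\<Sum>t\<in>{0..<nw}. M $$ (j, t) * w k $ t)" if "M \<in> carrier_mat nw nw" for M
      using that j dim by (simp add: scalar_prod_def)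
    from this[OF pow_carrier_mat[OF S]] show ?thesis
      using j dim by (simp add: poly_shift_def pow)
  qed
  also have "\<dots> = (\<Sum>t\<in>{0..<nw}. (\<Sum>i\<le>degree q. coeff q i * (S ^\<^sub>m i) $$ (j, t)) * w k $ t)"
    by (simp add: sum_distrib_left sum_distrib_right sum.swap[of _ "{0..<nw}"] mult.assoc)
  also have "\<dots> = (poly_mat q S *\<^sub>v w k) $ j"
    using S j dim by (simp add: poly_mat_def scalar_prod_def)
  finally show "poly_shift q w k $ j = (poly_mat q S *\<^sub>v w k) $ j" .
qed (use S w[of k] in \<open>simp add: poly_shift_def poly_mat_def\<close>)

section \<open>The data vector obeys a linear recursion\<close>

text \<open>
  By the reconstruction of the state, the output, and with it the next data vector, is a linear
  function of the current data vector, input and exosignal. This is the unknown open-loop model that the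
  experiment and the closed loop have in common.
\<close>

lemma psi_next_linear:
  fixes w x u y \<eta> :: "'a \<Rightarrow> nat \<Rightarrow> real vec" and k :: "'a \<Rightarrow> nat"
    and l p m ne :: nat
  defines "g \<equiv> \<lambda>\<tau>. psi l (y \<tau>) (u \<tau>) (\<eta> \<tau>) (k \<tau>) @\<^sub>v (u \<tau> (k \<tau>) @\<^sub>v w \<tau> (k \<tau>))"
    and "N \<equiv> p * l + (m * l + ne)"
  assumes S: "S \<in> carrier_mat nw nw" and A: "A \<in> carrier_mat n n" and B: "B \<in> carrier_mat n m"
    and P: "P \<in> carrier_mat n nw" and C: "C \<in> carrier_mat p n" and Q: "Q \<in> carrier_mat p nw"
    and \<Phi>: "\<Phi> \<in> carrier_mat ne ne" and G: "G \<in> carrier_mat ne p"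
    and rank: "observability_rank A C l = n" and det: "det S \<noteq> 0"
    and l: "\<And>\<tau>. \<tau> \<in> D \<Longrightarrow> l \<le> k \<tau>"
    and plant: "\<And>\<tau>. \<tau> \<in> D \<Longrightarrow> plant_traj {k \<tau> - l..k \<tau>} S A B P C Q (w \<tau>) (x \<tau>) (u \<tau>) (y \<tau>)"
    and im: "\<And>\<tau>. \<tau> \<in> D \<Longrightarrow> im_traj {k \<tau>} \<Phi> G (y \<tau>) (\<eta> \<tau>)"
  shows "linear_fun_of D (N + (m + nw)) g n (\<lambda>\<tau>. x \<tau> (k \<tau>))"
    and "linear_fun_of D (N + (m + nw)) g N (\<lambda>\<tau>. psi l (y \<tau>) (u \<tau>) (\<eta> \<tau>) (Suc (k \<tau>)))"
proof -
  let ?s = "N + (m + nw)"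
  have carrier: "w \<tau> i \<in> carrier_vec nw" "x \<tau> i \<in> carrier_vec n" "u \<tau> i \<in> carrier_vec m"
      "y \<tau> i \<in> carrier_vec p" "y \<tau> i = C *\<^sub>v x \<tau> i + Q *\<^sub>v w \<tau> i"
    if "\<tau> \<in> D" "k \<tau> - l \<le> i" "i \<le> k \<tau>" for \<tau> i
    using plant[OF that(1)] that S A B C Q
    by (auto simp: plant_traj_def intro!: add_carrier_vec mult_mat_vec_carrier)
  have \<eta>: "\<eta> \<tau> (k \<tau>) \<in> carrier_vec ne" "\<eta> \<tau> (Suc (k \<tau>)) = \<Phi> *\<^sub>v \<eta> \<tau> (k \<tau>) + G *\<^sub>v y \<tau> (k \<tau>)"
    if "\<tau> \<in> D" for \<tau>
    using im[OF that] \<Phi> by (auto simp: im_traj_def)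
  have now: "u \<tau> (k \<tau>) \<in> carrier_vec m" "w \<tau> (k \<tau>) \<in> carrier_vec nw" "x \<tau> (k \<tau>) \<in> carrier_vec n"
    if "\<tau> \<in> D" for \<tau>
    using carrier[OF that, of "k \<tau>"] by auto
  have past_y: "past l (y \<tau>) (k \<tau>) \<in> carrier_vec (p * l)" if "\<tau> \<in> D" for \<tau>
    using carrier[OF that] l[OF that] by (intro past_carrier) auto
  have past_u: "past l (u \<tau>) (k \<tau>) \<in> carrier_vec (m * l)" if "\<tau> \<in> D" for \<tau>
    using carrier[OF that] l[OF that] by (intro past_carrier) auto
  have g: "g \<tau> \<in> carrier_vec ?s" if "\<tau> \<in> D" for \<tau>
    using past_y[OF that] past_u[OF that] \<eta>[OF that] now[OF that]
    by (auto simp: g_def psi_eq N_def)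
  have psi_c: "psi l (y \<tau>) (u \<tau>) (\<eta> \<tau>) (k \<tau>) \<in> carrier_vec N"
    and uw_c: "u \<tau> (k \<tau>) @\<^sub>v w \<tau> (k \<tau>) \<in> carrier_vec (m + nw)"
    and u\<eta>_c: "past l (u \<tau>) (k \<tau>) @\<^sub>v \<eta> \<tau> (k \<tau>) \<in> carrier_vec (m * l + ne)" if "\<tau> \<in> D" for \<tau>
    using past_y[OF that] past_u[OF that] \<eta>[OF that] now[OF that]
    by (auto simp: psi_eq N_def)
  have lin_all: "linear_fun_of D ?s g N (\<lambda>\<tau>. psi l (y \<tau>) (u \<tau>) (\<eta> \<tau>) (k \<tau>))"
    "linear_fun_of D ?s g (m + nw) (\<lambda>\<tau>. u \<tau> (k \<tau>) @\<^sub>v w \<tau> (k \<tau>))"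
    using linear_fun_of_append_parts[OF linear_fun_of_refl[of D g, OF g, unfolded g_def]]
      psi_c uw_c unfolding g_def by blast+
  have lin_uw: "linear_fun_of D ?s g m (\<lambda>\<tau>. u \<tau> (k \<tau>))" "linear_fun_of D ?s g nw (\<lambda>\<tau>. w \<tau> (k \<tau>))"
    using linear_fun_of_append_parts[OF lin_all(2)] now by blast+
  have lin_y_past: "linear_fun_of D ?s g (p * l) (\<lambda>\<tau>. past l (y \<tau>) (k \<tau>))"
    and lin_u\<eta>: "linear_fun_of D ?s g (m * l + ne) (\<lambda>\<tau>. past l (u \<tau>) (k \<tau>) @\<^sub>v \<eta> \<tau> (k \<tau>))"
    using linear_fun_of_append_parts[OF lin_all(1)[unfolded psi_eq N_def]] past_y u\<eta>_c
    unfolding N_def by blast+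
  have lin_u_past: "linear_fun_of D ?s g (m * l) (\<lambda>\<tau>. past l (u \<tau>) (k \<tau>))"
    and lin_\<eta>: "linear_fun_of D ?s g ne (\<lambda>\<tau>. \<eta> \<tau> (k \<tau>))"
    using linear_fun_of_append_parts[OF lin_u\<eta>] past_u \<eta>(1) by blast+
  have traj: "plant_traj {k \<tau> - l..<k \<tau>} S A B P C Q (w \<tau>) (x \<tau>) (u \<tau>) (y \<tau>)" if "\<tau> \<in> D" for \<tau>
    using plant[OF that] by (auto simp: plant_traj_def)
  show lin_x: "linear_fun_of D ?s g n (\<lambda>\<tau>. x \<tau> (k \<tau>))"
  proof (rule linear_fun_of_trans)
    show "linear_fun_of D ?s g (p * l + (m * l + nw))
        (\<lambda>\<tau>. past l (y \<tau>) (k \<tau>) @\<^sub>v (past l (u \<tau>) (k \<tau>) @\<^sub>v w \<tau> (k \<tau>)))"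
      by (intro linear_fun_of_append lin_y_past lin_u_past lin_uw)
    show "linear_fun_of D (p * l + (m * l + nw))
        (\<lambda>\<tau>. past l (y \<tau>) (k \<tau>) @\<^sub>v (past l (u \<tau>) (k \<tau>) @\<^sub>v w \<tau> (k \<tau>))) n (\<lambda>\<tau>. x \<tau> (k \<tau>))"
      by (rule state_linear_in_window[OF S A B P C Q rank det]) (use l traj now in auto)
  qed
  have "linear_fun_of D ?s g p (\<lambda>\<tau>. C *\<^sub>v x \<tau> (k \<tau>) + Q *\<^sub>v w \<tau> (k \<tau>))"
    by (intro linear_fun_of_add linear_fun_of_mult[OF lin_x C] linear_fun_of_mult[OF lin_uw(2) Q])
  then have lin_y: "linear_fun_of D ?s g p (\<lambda>\<tau>. y \<tau> (k \<tau>))"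
    using carrier(5) by (auto elim!: linear_fun_of_cong)
  have "linear_fun_of D ?s g (p * l + (m * l + ne)) (\<lambda>\<tau>.
      (block_shift p l *\<^sub>v past l (y \<tau>) (k \<tau>) + last_block p l *\<^sub>v y \<tau> (k \<tau>)) @\<^sub>v
      ((block_shift m l *\<^sub>v past l (u \<tau>) (k \<tau>) + last_block m l *\<^sub>v u \<tau> (k \<tau>)) @\<^sub>v
       (\<Phi> *\<^sub>v \<eta> \<tau> (k \<tau>) + G *\<^sub>v y \<tau> (k \<tau>))))"
    by (intro linear_fun_of_append linear_fun_of_add
        linear_fun_of_mult[OF lin_y_past block_shift_carrier] linear_fun_of_mult[OF lin_y last_block_carrier]
        linear_fun_of_mult[OF lin_u_past block_shift_carrier] linear_fun_of_mult[OF lin_uw(1) last_block_carrier]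
        linear_fun_of_mult[OF lin_\<eta> \<Phi>] linear_fun_of_mult[OF lin_y G])
  moreover have "psi l (y \<tau>) (u \<tau>) (\<eta> \<tau>) (Suc (k \<tau>)) =
      (block_shift p l *\<^sub>v past l (y \<tau>) (k \<tau>) + last_block p l *\<^sub>v y \<tau> (k \<tau>)) @\<^sub>v
      ((block_shift m l *\<^sub>v past l (u \<tau>) (k \<tau>) + last_block m l *\<^sub>v u \<tau> (k \<tau>)) @\<^sub>v
       (\<Phi> *\<^sub>v \<eta> \<tau> (k \<tau>) + G *\<^sub>v y \<tau> (k \<tau>)))" if "\<tau> \<in> D" for \<tau>
    using past_Suc[OF l[OF that], of "y \<tau>" p] past_Suc[OF l[OF that], of "u \<tau>" m]
      carrier[OF that] \<eta>[OF that] by (simp add: psi_eq shift_in_def)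
  ultimately show "linear_fun_of D ?s g N (\<lambda>\<tau>. psi l (y \<tau>) (u \<tau>) (\<eta> \<tau>) (Suc (k \<tau>)))"
    unfolding N_def by (rule linear_fun_of_cong)
qed


section \<open>Data matrices\<close>

lemma append_rows_index:
  assumes "M \<in> carrier_mat r c" "M' \<in> carrier_mat r' c" "i < r + r'" "j < c"
  shows "(M @\<^sub>r M') $$ (i, j) = (if i < r then M $$ (i, j) else M' $$ (i - r, j))"
  using assms by (auto simp: append_rows_def)

lemma append_rows_eq:
  assumes M: "M \<in> carrier_mat r c" "M' \<in> carrier_mat r' c"
    and N: "N \<in> carrier_mat r c" "N' \<in> carrier_mat r' c"
    and eq: "M @\<^sub>r M' = N @\<^sub>r N'"
  shows "M = N" "M' = N'"
proof -
  have "M $$ (i, j) = N $$ (i, j)" if "i < r" "j < c" for i j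
    using append_rows_index[OF M, of i j] append_rows_index[OF N, of i j] that eq by simp
  then show "M = N" using M N by (intro eq_matI) auto
  have "M' $$ (i, j) = N' $$ (i, j)" if "i < r'" "j < c" for i j
    using append_rows_index[OF M, of "r + i" j] append_rows_index[OF N, of "r + i" j] that eq by simp
  then show "M' = N'" using M N by (intro eq_matI) auto
qed

lemma append_rows_mult:
  fixes M M' Y :: "'a :: comm_ring_1 mat"
  assumes M: "M \<in> carrier_mat r c" "M' \<in> carrier_mat r' c" and Y: "Y \<in> carrier_mat c s"
  shows "(M @\<^sub>r M') * Y = M * Y @\<^sub>r M' * Y"
proof (rule eq_matI)
  have MM: "M @\<^sub>r M' \<in> carrier_mat (r + r') c" using M by (rule carrier_append_rows)
  have MY: "M * Y \<in> carrier_mat r s" "M' * Y \<in> carrier_mat r' s" using M Y by auto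
  have MMY: "M * Y @\<^sub>r M' * Y \<in> carrier_mat (r + r') s" using MY by (rule carrier_append_rows)
  show "dim_row ((M @\<^sub>r M') * Y) = dim_row (M * Y @\<^sub>r M' * Y)"
    "dim_col ((M @\<^sub>r M') * Y) = dim_col (M * Y @\<^sub>r M' * Y)"
    using MM MMY Y by auto
  fix i j assume "i < dim_row (M * Y @\<^sub>r M' * Y)" "j < dim_col (M * Y @\<^sub>r M' * Y)"
  then have ij: "i < r + r'" "j < s" using MMY by auto
  have "((M @\<^sub>r M') * Y) $$ (i, j) = ((M @\<^sub>r M') *\<^sub>v col Y j) $ i"
    using MM Y ij by auto
  also have "(M @\<^sub>r M') *\<^sub>v col Y j = (M *\<^sub>v col Y j) @\<^sub>v (M' *\<^sub>v col Y j)"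
    using Y by (intro mat_mult_append[OF M]) auto
  also have "\<dots> $ i = (M * Y @\<^sub>r M' * Y) $$ (i, j)"
    using append_rows_index[OF MY ij] M Y ij by auto
  finally show "((M @\<^sub>r M') * Y) $$ (i, j) = (M * Y @\<^sub>r M' * Y) $$ (i, j)" .
qed

lemma data_mat_carrier: "data_mat r f a b \<in> carrier_mat r (Suc b - a)"
  unfolding data_mat_def by (rule carrier_matI) (simp_all del: upt_Suc)

lemma data_mat_index: "i < r \<Longrightarrow> j < Suc b - a \<Longrightarrow> data_mat r f a b $$ (i, j) = f (a + j) $ i"
  by (simp add: data_mat_def mat_of_cols_index del: upt_Suc)

lemma data_mat_col:
  assumes "j < Suc b - a" "f (a + j) \<in> carrier_vec r"
  shows "col (data_mat r f a b) j = f (a + j)"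
  using assms data_mat_carrier[of r f a b] by (intro eq_vecI) (auto simp: data_mat_index)

lemma data_mat_append:
  assumes "\<And>k. a \<le> k \<Longrightarrow> k \<le> b \<Longrightarrow> f k \<in> carrier_vec r \<and> g k \<in> carrier_vec r'"
  shows "data_mat r f a b @\<^sub>r data_mat r' g a b = data_mat (r + r') (\<lambda>k. f k @\<^sub>v g k) a b"
proof (rule eq_matI)
  note c = data_mat_carrier[of r f a b] data_mat_carrier[of r' g a b]
    data_mat_carrier[of "r + r'" "\<lambda>k. f k @\<^sub>v g k" a b]
  fix i j assume "i < dim_row (data_mat (r + r') (\<lambda>k. f k @\<^sub>v g k) a b)"
    "j < dim_col (data_mat (r + r') (\<lambda>k. f k @\<^sub>v g k) a b)"
  then have ij: "i < r + r'" "j < Suc b - a" using c(3) by auto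
  then have "f (a + j) \<in> carrier_vec r" "g (a + j) \<in> carrier_vec r'" using assms[of "a + j"] by auto
  then show "(data_mat r f a b @\<^sub>r data_mat r' g a b) $$ (i, j) =
      data_mat (r + r') (\<lambda>k. f k @\<^sub>v g k) a b $$ (i, j)"
    using append_rows_index[OF c(1,2) ij] ij by (auto simp: data_mat_index)
qed (use carrier_append_rows[OF data_mat_carrier[of r f a b] data_mat_carrier[of r' g a b]]
    data_mat_carrier[of "r + r'" "\<lambda>k. f k @\<^sub>v g k" a b] in auto)

lemma data_mat_eq_mult:
  assumes H: "H \<in> carrier_mat r c"
    and *: "\<And>k. a \<le> k \<Longrightarrow> k \<le> b \<Longrightarrow> g k \<in> carrier_vec c \<and> f (Suc k) = H *\<^sub>v g k"
  shows "data_mat r f (a + 1) (b + 1) = H * data_mat c g a b"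
proof (rule mat_col_eqI)
  note d = data_mat_carrier[of c g a b]
  fix j assume "j < dim_col (H * data_mat c g a b)"
  then have j: "j < Suc b - a" using d by auto
  then have gj: "g (a + j) \<in> carrier_vec c" "f (Suc (a + j)) = H *\<^sub>v g (a + j)" using *[of "a + j"] by auto
  show "col (data_mat r f (a + 1) (b + 1)) j = col (H * data_mat c g a b) j"
    using data_mat_col[of j "b + 1" "a + 1" f r] data_mat_col[of j b a g c] j gj H d
    by (auto intro: mult_mat_vec_carrier)
qed (use H data_mat_carrier[of r f "a + 1" "b + 1"] data_mat_carrier[of c g a b] in auto)

text \<open>
  A bound that is linear in the norm of the initial value gives both properties: \<open>b\<close> is bounded,
  which yields stability, and tends to zero, which yields attractivity.
\<close>

lemma origin_gas_if_decay_bound: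
  assumes b: "b \<longlonglongrightarrow> 0"
    and Z: "\<And>z k. z \<in> Z \<Longrightarrow> euclid_norm (z k) \<le> b k * euclid_norm (z 0)"
  shows "origin_gas Z"
proof -
  obtain c where c: "0 < c" "\<And>k. \<bar>b k\<bar> \<le> c"
    using convergent_imp_Bseq[OF convergentI[OF b]] by (auto simp: Bseq_def)
  have "\<exists>\<delta>>0. \<forall>z\<in>Z. euclid_norm (z 0) < \<delta> \<longrightarrow> (\<forall>k. euclid_norm (z k) < \<epsilon>)" if "0 < \<epsilon>" for \<epsilon>
  proof (intro exI[of _ "\<epsilon> / c"] conjI ballI impI allI)
    fix z k assume z: "z \<in> Z" "euclid_norm (z 0) < \<epsilon> / c"
    have "euclid_norm (z k) \<le> b k * euclid_norm (z 0)" by (rule Z[OF z(1)])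
    also have "\<dots> \<le> c * euclid_norm (z 0)"
      using c(2)[of k] by (intro mult_right_mono euclid_norm_nonneg) auto
    also have "\<dots> < \<epsilon>" using z(2) c(1) by (simp add: field_simps)
    finally show "euclid_norm (z k) < \<epsilon>" .
  qed (use that c in auto)
  moreover have "(\<lambda>k. euclid_norm (z k)) \<longlonglongrightarrow> 0" if "z \<in> Z" for z
  proof (rule tendsto_sandwich[of "\<lambda>_. 0"])
    show "(\<lambda>k. b k * euclid_norm (z 0)) \<longlonglongrightarrow> 0"
      using tendsto_mult_right[OF b, of "euclid_norm (z 0)"] by simp
    show "\<forall>\<^sub>F k in sequentially. euclid_norm (z k) \<le> b k * euclid_norm (z 0)"
      using Z[OF that] by simp
    show "\<forall>\<^sub>F k in sequentially. 0 \<le> euclid_norm (z k)"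
      using euclid_norm_nonneg by simp
  qed simp
  ultimately show ?thesis by (auto simp: origin_gas_def)
qed

lemma det_nonzero_if_no_zero_eigenvalue:
  assumes S: "S \<in> carrier_mat n n" and ev: "\<not> eigenvalue (map_mat complex_of_real S) 0"
  shows "det S \<noteq> 0"
proof
  assume "det S = 0"
  then obtain v where v: "v \<in> carrier_vec n" "v \<noteq> 0\<^sub>v n" "S *\<^sub>v v = 0\<^sub>v n"
    using det_0_iff_vec_prod_zero[OF S] by auto
  have "map_mat complex_of_real S *\<^sub>v map_vec complex_of_real v = map_vec complex_of_real (S *\<^sub>v v)"
    by (rule of_real_hom.mult_mat_vec_hom[OF S v(1), symmetric])
  then have "eigenvector (map_mat complex_of_real S) (map_vec complex_of_real v) 0"
    using S v by (auto simp: eigenvector_def)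
  then show False using ev by (auto simp: eigenvalue_def)
qed


section \<open>The closed loop\<close>

lemma closed_loop_poly_shift:
  assumes S: "S \<in> carrier_mat nw nw" and A: "A \<in> carrier_mat n n" and B: "B \<in> carrier_mat n m"
    and P: "P \<in> carrier_mat n nw" and C: "C \<in> carrier_mat p n" and Q: "Q \<in> carrier_mat p nw"
    and F: "F \<in> carrier_mat nc nc" and L: "L \<in> carrier_mat nc p" and Bc: "Bc \<in> carrier_mat nc m"
    and \<Phi>: "\<Phi> \<in> carrier_mat ne ne" and G: "G \<in> carrier_mat ne p" and K: "K \<in> carrier_mat m (nc + ne)"
    and cl: "closed_loop S A B P C Q F L Bc \<Phi> G K w x \<chi> \<eta> u y"
  shows "closed_loop S A B P C Q F L Bc \<Phi> G K (poly_shift q w) (poly_shift q x) (poly_shift q \<chi>)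
    (poly_shift q \<eta>) (poly_shift q u) (poly_shift q y)"
proof -
  have c: "w k \<in> carrier_vec nw" "x k \<in> carrier_vec n" "u k \<in> carrier_vec m" "\<eta> k \<in> carrier_vec ne"
      "\<chi> k \<in> carrier_vec nc" for k
    using cl S A B F \<Phi> by (auto simp: closed_loop_def plant_traj_def im_traj_def)
  have eqs: "(\<lambda>k. w (Suc k)) = (\<lambda>k. S *\<^sub>v w k)" "(\<lambda>k. x (Suc k)) = (\<lambda>k. A *\<^sub>v x k + B *\<^sub>v u k + P *\<^sub>v w k)"
    "y = (\<lambda>k. C *\<^sub>v x k + Q *\<^sub>v w k)" "(\<lambda>k. \<eta> (Suc k)) = (\<lambda>k. \<Phi> *\<^sub>v \<eta> k + G *\<^sub>v y k)"
    "(\<lambda>k. \<chi> (Suc k)) = (\<lambda>k. F *\<^sub>v \<chi> k + L *\<^sub>v y k + Bc *\<^sub>v u k)" "u = (\<lambda>k. K *\<^sub>v (\<chi> k @\<^sub>v \<eta> k))"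
    using cl by (auto simp: closed_loop_def plant_traj_def im_traj_def)
  have y: "y k \<in> carrier_vec p" for k
    unfolding eqs(3) using C Q c by (intro add_carrier_vec mult_mat_vec_carrier)
  have Mc: "M *\<^sub>v f k \<in> carrier_vec r" if "M \<in> carrier_mat r c" "\<And>k. f k \<in> carrier_vec c" for M r c f and k :: nat
    using that by (intro mult_mat_vec_carrier)
  have chi_eta: "\<chi> k @\<^sub>v \<eta> k \<in> carrier_vec (nc + ne)" for k using c by simp
  note [simp] = poly_shift_mult[OF S c(1)] poly_shift_mult[OF A c(2)] poly_shift_mult[OF B c(3)]
    poly_shift_mult[OF P c(1)] poly_shift_mult[OF C c(2)] poly_shift_mult[OF Q c(1)]
    poly_shift_mult[OF F c(5)] poly_shift_mult[OF L y] poly_shift_mult[OF Bc c(3)]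
    poly_shift_mult[OF \<Phi> c(4)] poly_shift_mult[OF G y]
  have "poly_shift q w (Suc k) = S *\<^sub>v poly_shift q w k" for k
    by (simp add: poly_shift_Suc eqs)
  moreover have "poly_shift q x (Suc k) = A *\<^sub>v poly_shift q x k + B *\<^sub>v poly_shift q u k + P *\<^sub>v poly_shift q w k" for k
    unfolding poly_shift_Suc[of q x] eqs(2)
    by (subst poly_shift_add[of _ n]; (subst poly_shift_add[of _ n])?)
      (auto intro!: Mc[OF A c(2)] Mc[OF B c(3)] Mc[OF P c(1)] add_carrier_vec)
  moreover have "poly_shift q y k = C *\<^sub>v poly_shift q x k + Q *\<^sub>v poly_shift q w k" for k
    unfolding eqs(3)
    by (subst poly_shift_add[of _ p]) (auto intro!: Mc[OF C c(2)] Mc[OF Q c(1)])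
  moreover have "poly_shift q \<eta> (Suc k) = \<Phi> *\<^sub>v poly_shift q \<eta> k + G *\<^sub>v poly_shift q y k" for k
    unfolding poly_shift_Suc[of q \<eta>] eqs(4)
    by (subst poly_shift_add[of _ ne]) (auto intro!: Mc[OF \<Phi> c(4)] Mc[OF G y])
  moreover have "poly_shift q \<chi> (Suc k) = F *\<^sub>v poly_shift q \<chi> k + L *\<^sub>v poly_shift q y k + Bc *\<^sub>v poly_shift q u k" for k
    unfolding poly_shift_Suc[of q \<chi>] eqs(5)
    by (subst poly_shift_add[of _ nc]; (subst poly_shift_add[of _ nc])?)
      (auto intro!: Mc[OF F c(5)] Mc[OF L y] Mc[OF Bc c(3)] add_carrier_vec)
  moreover have "poly_shift q u k = K *\<^sub>v (poly_shift q \<chi> k @\<^sub>v poly_shift q \<eta> k)" for k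
    by (subst eqs(6)) (simp add: poly_shift_mult[OF K chi_eta] poly_shift_append[OF c(5,4)])
  moreover have "K *\<^sub>v (poly_shift q \<chi> k @\<^sub>v poly_shift q \<eta> k) \<in> carrier_vec m" for k
    using poly_shift_carrier[OF c(5)] poly_shift_carrier[OF c(4)]
    by (intro mult_mat_vec_carrier[OF K] append_carrier_vec)
  ultimately show ?thesis
    using S A B F \<Phi> c by (simp add: closed_loop_def plant_traj_def im_traj_def poly_shift_carrier)
qed

text \<open>
  From time \<open>l\<close> on the controller state consists of the last \<open>l\<close> outputs and inputs, whatever its
  initial value.
\<close>

lemma closed_loop_state_eq_psi:
  assumes \<Phi>: "\<Phi> \<in> carrier_mat ne ne"
    and A: "A \<in> carrier_mat n n" and B: "B \<in> carrier_mat n m"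
    and S: "S \<in> carrier_mat nw nw" and C: "C \<in> carrier_mat p n" and Q: "Q \<in> carrier_mat p nw"
    and l: "1 \<le> l" "l \<le> k"
    and cl: "closed_loop S A B P C Q (ctrl_F p m l) (ctrl_L p m l) (ctrl_B p m l) \<Phi> G K w x \<chi> \<eta> u y"
  shows "\<chi> k @\<^sub>v \<eta> k = psi l y u \<eta> k"
proof -
  have c: "w k \<in> carrier_vec nw" "x k \<in> carrier_vec n" "u k \<in> carrier_vec m"
      "\<chi> k \<in> carrier_vec (p * l + m * l)" for k
    using cl S A B ctrl_carrier(1)[of p m l] by (auto simp: closed_loop_def plant_traj_def)
  have step: "\<chi> (Suc k) = ctrl_F p m l *\<^sub>v \<chi> k + ctrl_L p m l *\<^sub>v y k + ctrl_B p m l *\<^sub>v u k"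
    and y_eq: "y k = C *\<^sub>v x k + Q *\<^sub>v w k" for k
    using cl by (auto simp: closed_loop_def plant_traj_def)
  have y: "y k \<in> carrier_vec p" for k
    unfolding y_eq using C Q c by (intro add_carrier_vec mult_mat_vec_carrier)
  define a where "a = (\<lambda>k. vec_first (\<chi> k) (p * l))"
  define b where "b = (\<lambda>k. vec_last (\<chi> k) (m * l))"
  have a: "a k \<in> carrier_vec (p * l)" and b: "b k \<in> carrier_vec (m * l)"
    and \<chi>: "\<chi> k = a k @\<^sub>v b k" for k
    using c(4)[of k] by (auto simp: a_def b_def)
  have "a (Suc k) @\<^sub>v b (Suc k) = shift_in p l (a k) (y k) @\<^sub>v shift_in m l (b k) (u k)" for k
    using step[of k] ctrl_update[OF a b y c(3) l(1), of k k k k] unfolding \<chi> by simp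
  then have "a (Suc k) = shift_in p l (a k) (y k) \<and> b (Suc k) = shift_in m l (b k) (u k)" for k
    using append_vec_eq[OF a shift_in_carrier] by blast
  then have "a k = past l y k" "b k = past l u k"
    using shift_register_eq_past[of a p l y k] shift_register_eq_past[of b m l u k] a b y c(3) l(2)
    by auto
  then show ?thesis by (simp add: \<chi> psi_eq append_vec_assoc)
qed

text \<open>
  The constraints make \<open>Y\<close> combine the experiments so that the exosignal cancels,
  \<open>W0 Y = L0 M Y = 0\<close>, while \<open>\<Psi>0 Y = X\<close> and \<open>U1 Y = K X\<close>. Multiplying the data equation
  \<open>\<Psi>1 = H (\<Psi>0, U1, W0)\<close> by \<open>Y\<close> therefore gives \<open>\<Psi>1 Y = \<Theta> X\<close> with
  \<open>\<Theta> = H (I, K, 0)\<close>, the matrix of the recursion with \<open>u = K \<psi>\<close> and \<open>w = 0\<close>, and the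
  inequality of the program becomes a Lyapunov inequality for \<open>\<Theta>\<close>.
\<close>

lemma sdp_closed_loop_powers_tendsto_0:
  assumes H: "H \<in> carrier_mat N (N + (m + nw))"
    and \<Psi>0: "\<Psi>0 \<in> carrier_mat N t" and U1: "U1 \<in> carrier_mat m t" and W0: "W0 \<in> carrier_mat nw t"
    and L0: "L0 \<in> carrier_mat nw nwh" and M: "M \<in> carrier_mat nwh t" and W0_eq: "W0 = L0 * M"
    and \<Psi>1: "\<Psi>1 = H * (\<Psi>0 @\<^sub>r (U1 @\<^sub>r W0))"
    and sdp: "sdp_feasible \<Psi>0 \<Psi>1 M X Y"
    and K_def: "K = U1 * Y * the (mat_inverse X)"
  shows "K \<in> carrier_mat m N"
    and "(\<lambda>k. entry_sum ((H * (1\<^sub>m N @\<^sub>r (K @\<^sub>r 0\<^sub>m nw N))) ^\<^sub>m k)) \<longlonglongrightarrow> 0"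
proof -
  have X: "X \<in> carrier_mat N N" "pos_def X" and Y: "Y \<in> carrier_mat t N"
    and eq: "X @\<^sub>r 0\<^sub>m nwh N = (\<Psi>0 @\<^sub>r M) * Y"
    and lmi: "pos_def (four_block_mat X (\<Psi>1 * Y) (transpose_mat (\<Psi>1 * Y)) X)"
    using sdp \<Psi>0 M by (auto simp: sdp_feasible_def)
  have "mat_inverse X \<noteq> None"
    using mat_inverse(1)[OF X(1), of "()"] det_non_zero_imp_unit[OF X(1) pos_def_det_nonzero[OF X], of "()"]
    by blast
  then obtain Xi where Xi: "mat_inverse X = Some Xi" by auto
  then have inv: "Xi * X = 1\<^sub>m N" "Xi \<in> carrier_mat N N"
    using mat_inverse(2)[OF X(1) Xi] by auto
  have UY: "U1 * Y \<in> carrier_mat m N" using U1 Y by simp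
  have K_eq: "K = U1 * Y * Xi" by (simp add: K_def Xi)
  show K: "K \<in> carrier_mat m N" unfolding K_eq using UY inv by simp
  have KX: "K * X = U1 * Y"
    unfolding K_eq using assoc_mult_mat[OF UY inv(2) X(1)] inv(1) right_mult_one_mat[OF UY] by simp
  have "X @\<^sub>r 0\<^sub>m nwh N = \<Psi>0 * Y @\<^sub>r M * Y"
    unfolding eq by (rule append_rows_mult[OF \<Psi>0 M Y])
  then have \<Psi>Y: "\<Psi>0 * Y = X" and MY: "M * Y = 0\<^sub>m nwh N"
    using append_rows_eq[of X N N "0\<^sub>m nwh N" nwh "\<Psi>0 * Y" "M * Y"] X \<Psi>0 M Y by auto
  \<comment> \<open>The combinations of samples in \<open>Y\<close> contain no trace of the unknown exosignal.\<close>
  have WY: "W0 * Y = 0\<^sub>m nw N"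
    unfolding W0_eq using assoc_mult_mat[OF L0 M Y] MY L0 by simp
  let ?E = "1\<^sub>m N @\<^sub>r (K @\<^sub>r 0\<^sub>m nw N)"
  have K0: "K @\<^sub>r 0\<^sub>m nw N \<in> carrier_mat (m + nw) N" using K by simp
  have E: "?E \<in> carrier_mat (N + (m + nw)) N" using K0 by simp
  have UW: "U1 @\<^sub>r W0 \<in> carrier_mat (m + nw) t" using U1 W0 by simp
  have UWY: "(U1 @\<^sub>r W0) * Y = (K @\<^sub>r 0\<^sub>m nw N) * X"
    using append_rows_mult[OF U1 W0 Y] append_rows_mult[OF K, of "0\<^sub>m nw N" nw X N] X KX WY by simp
  have "\<Psi>1 * Y = H * ((\<Psi>0 @\<^sub>r (U1 @\<^sub>r W0)) * Y)"
    unfolding \<Psi>1 by (rule assoc_mult_mat[OF H carrier_append_rows[OF \<Psi>0 UW] Y])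
  also have "(\<Psi>0 @\<^sub>r (U1 @\<^sub>r W0)) * Y = ?E * X"
    using append_rows_mult[OF \<Psi>0 UW Y] append_rows_mult[OF one_carrier_mat K0 X(1)] \<Psi>Y UWY X by simp
  also have "H * (?E * X) = H * ?E * X"
    by (rule assoc_mult_mat[OF H E X(1), symmetric])
  finally have "\<Psi>1 * Y = H * ?E * X" .
  then show "(\<lambda>k. entry_sum ((H * ?E) ^\<^sub>m k)) \<longlonglongrightarrow> 0"
    using lmi_powers_tendsto_0[OF X, of "H * ?E"] lmi H E by simp
qed

text \<open>
  Here is the role of the internal model. The blocks of \<open>\<eta>\<close> are successive shifts of the first one,
  \<open>\<eta>\<^sub>i k = \<eta>\<^sub>1 (k + i - 1)\<close>, and the last block row states \<open>q(\<sigma>) \<eta>\<^sub>1 = y\<close>.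
\<close>

lemma internal_model_poly_shift:
  assumes monic: "lead_coeff q = 1" and d: "1 \<le> degree q"
    and y: "\<And>k. y k \<in> carrier_vec p" and \<eta>: "\<And>k. \<eta> k \<in> carrier_vec (p * degree q)"
    and step: "\<And>k. \<eta> (Suc k) = im_Phi p q *\<^sub>v \<eta> k + im_G p (degree q) *\<^sub>v y k"
    and j: "j < p"
  shows "poly_shift q \<eta> k $ j = y k $ j"
proof -
  let ?d = "degree q"
  \<comment> \<open>Block 0 of \<open>\<eta>\<close>, at offset \<open>p * 0\<close>, is the first block \<open>\<eta>\<^sub>1\<close>.\<close>
  have next_block: "\<eta> (Suc k) $ (p * i + j) =
      (if Suc i < ?d then \<eta> k $ (p * Suc i + j) else y k $ j - (\<Sum>t<?d. coeff q t * \<eta> k $ (p * t + j)))"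
    if i: "i < ?d" for k i
    using im_Phi_mult_index[OF \<eta> i j, of k] last_block_mult_index[OF y i j, of k]
      block_index_less[OF i j] i im_carrier(2)[of p ?d] unfolding step im_G_eq
    by (auto simp: last_block_def)
  have shifted: "\<eta> (k + i) $ j = \<eta> k $ (p * i + j)" if "i < ?d" for k i
    using that
  proof (induction i arbitrary: k)
    case (Suc i)
    then show ?case using Suc.IH[of "Suc k"] next_block[of i k] by simp
  qed simp
  have "j < p * ?d" using block_index_less[of 0 ?d j p] d j by simp
  then have "poly_shift q \<eta> k $ j = (\<Sum>i\<le>?d. coeff q i * \<eta> (k + i) $ j)"
    using \<eta>[of k] by (simp add: poly_shift_def)
  also have "\<dots> = (\<Sum>i<?d. coeff q i * \<eta> (k + i) $ j) + \<eta> (k + ?d) $ j"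
    using monic by (simp add: lessThan_Suc_atMost[symmetric])
  also have "(\<Sum>i<?d. coeff q i * \<eta> (k + i) $ j) = (\<Sum>i<?d. coeff q i * \<eta> k $ (p * i + j))"
    by (intro sum.cong) (auto simp: shifted)
  also have "\<eta> (k + ?d) $ j = \<eta> (Suc k + (?d - 1)) $ j" using d by simp
  also have "\<dots> = \<eta> (Suc k) $ (p * (?d - 1) + j)" using d by (intro shifted) simp
  also have "\<dots> = y k $ j - (\<Sum>i<?d. coeff q i * \<eta> k $ (p * i + j))"
    using next_block[of "?d - 1" k] d by simp
  finally show ?thesis by simp
qed

text \<open>
  The recursion with \<open>\<Theta>\<close> is available from time \<open>l\<close> on, when the controller holds past samples.
  The first \<open>l\<close> steps increase the norm by at most a constant factor each, since the closed loop is
  linear; afterwards the controller state is governed by the powers of \<open>\<Theta>\<close>, and the plant state is a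
  linear function of it.
\<close>

lemma closed_loop_origin_gas:
  assumes S: "S \<in> carrier_mat nw nw" and A: "A \<in> carrier_mat n n" and B: "B \<in> carrier_mat n m"
    and P: "P \<in> carrier_mat n nw" and C: "C \<in> carrier_mat p n" and Q: "Q \<in> carrier_mat p nw"
    and F: "F \<in> carrier_mat nc nc" and L: "L \<in> carrier_mat nc p" and Bc: "Bc \<in> carrier_mat nc m"
    and \<Phi>: "\<Phi> \<in> carrier_mat ne ne" and G: "G \<in> carrier_mat ne p" and K: "K \<in> carrier_mat m (nc + ne)"
    and \<Theta>: "\<Theta> \<in> carrier_mat (nc + ne) (nc + ne)" "(\<lambda>k. entry_sum (\<Theta> ^\<^sub>m k)) \<longlonglongrightarrow> 0"
    and R: "R \<in> carrier_mat n (nc + ne)"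
    and later: "\<And>x \<chi> \<eta> u y k. closed_loop S A B P C Q F L Bc \<Phi> G K (\<lambda>_. 0\<^sub>v nw) x \<chi> \<eta> u y \<Longrightarrow> l \<le> k \<Longrightarrow>
      \<chi> (Suc k) @\<^sub>v \<eta> (Suc k) = \<Theta> *\<^sub>v (\<chi> k @\<^sub>v \<eta> k) \<and> x k = R *\<^sub>v (\<chi> k @\<^sub>v \<eta> k)"
  shows "origin_gas {z. \<exists>x \<chi> \<eta> u y. closed_loop S A B P C Q F L Bc \<Phi> G K (\<lambda>_. 0\<^sub>v nw) x \<chi> \<eta> u y \<and>
    z = (\<lambda>k. x k @\<^sub>v \<chi> k @\<^sub>v \<eta> k)}" (is "origin_gas ?Z")
proof -
  let ?cl = "closed_loop S A B P C Q F L Bc \<Phi> G K (\<lambda>_. 0\<^sub>v nw)"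
  have c: "x k \<in> carrier_vec n" "\<chi> k \<in> carrier_vec nc" "\<eta> k \<in> carrier_vec ne"
    if "?cl x \<chi> \<eta> u y" for x \<chi> \<eta> u y k
    using that A F \<Phi> by (auto simp: closed_loop_def plant_traj_def im_traj_def)
  obtain c1 where c1: "1 \<le> c1" and one_step:
    "\<And>x \<chi> \<eta> u y k. ?cl x \<chi> \<eta> u y \<Longrightarrow>
      euclid_norm (x (Suc k) @\<^sub>v \<chi> (Suc k) @\<^sub>v \<eta> (Suc k)) \<le> c1 * euclid_norm (x k @\<^sub>v \<chi> k @\<^sub>v \<eta> k)"
  proof -
    define D where "D = {(x, \<chi>, \<eta>, k). \<exists>u y. ?cl x \<chi> \<eta> u y \<and> k \<in> (UNIV :: nat set)}"
    define X where "X = (\<lambda>(x :: nat \<Rightarrow> real vec, \<chi> :: nat \<Rightarrow> real vec, \<eta> :: nat \<Rightarrow> real vec, k :: nat). x k)"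
    define X\<chi> where "X\<chi> = (\<lambda>(x :: nat \<Rightarrow> real vec, \<chi> :: nat \<Rightarrow> real vec, \<eta> :: nat \<Rightarrow> real vec, k :: nat). \<chi> k)"
    define X\<eta> where "X\<eta> = (\<lambda>(x :: nat \<Rightarrow> real vec, \<chi> :: nat \<Rightarrow> real vec, \<eta> :: nat \<Rightarrow> real vec, k :: nat). \<eta> k)"
    define g where "g = (\<lambda>\<tau>. X \<tau> @\<^sub>v (X\<chi> \<tau> @\<^sub>v X\<eta> \<tau>))"
    let ?s = "n + (nc + ne)"
    have Dc: "X \<tau> \<in> carrier_vec n" "X\<chi> \<tau> \<in> carrier_vec nc" "X\<eta> \<tau> \<in> carrier_vec ne"
      "X\<chi> \<tau> @\<^sub>v X\<eta> \<tau> \<in> carrier_vec (nc + ne)" if "\<tau> \<in> D" for \<tau>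
      using that c by (fastforce simp: D_def X_def X\<chi>_def X\<eta>_def)+
    then have g: "g \<tau> \<in> carrier_vec ?s" if "\<tau> \<in> D" for \<tau> using that by (simp add: g_def)
    have lin_x: "linear_fun_of D ?s g n X" and lin_\<chi>\<eta>: "linear_fun_of D ?s g (nc + ne) (\<lambda>\<tau>. X\<chi> \<tau> @\<^sub>v X\<eta> \<tau>)"
      using linear_fun_of_append_parts[OF linear_fun_of_refl[of D g, OF g, unfolded g_def] Dc(1,4)]
      unfolding g_def by blast+
    have lin_\<chi>: "linear_fun_of D ?s g nc X\<chi>" and lin_\<eta>: "linear_fun_of D ?s g ne X\<eta>"
      using linear_fun_of_append_parts[OF lin_\<chi>\<eta> Dc(2,3)] by blast+
    define U where "U = (\<lambda>\<tau>. K *\<^sub>v (X\<chi> \<tau> @\<^sub>v X\<eta> \<tau>))"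
    define Y where "Y = (\<lambda>\<tau>. C *\<^sub>v X \<tau>)"
    have lin_u: "linear_fun_of D ?s g m U" unfolding U_def by (rule linear_fun_of_mult[OF lin_\<chi>\<eta> K])
    have lin_y: "linear_fun_of D ?s g p Y" unfolding Y_def by (rule linear_fun_of_mult[OF lin_x C])
    have "linear_fun_of D ?s g (n + (nc + ne)) (\<lambda>\<tau>. (A *\<^sub>v X \<tau> + B *\<^sub>v U \<tau>) @\<^sub>v
        ((F *\<^sub>v X\<chi> \<tau> + L *\<^sub>v Y \<tau> + Bc *\<^sub>v U \<tau>) @\<^sub>v (\<Phi> *\<^sub>v X\<eta> \<tau> + G *\<^sub>v Y \<tau>)))"
      by (intro linear_fun_of_append linear_fun_of_add linear_fun_of_mult[OF lin_x A]
          linear_fun_of_mult[OF lin_u B] linear_fun_of_mult[OF lin_\<chi> F] linear_fun_of_mult[OF lin_y L]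
          linear_fun_of_mult[OF lin_u Bc] linear_fun_of_mult[OF lin_\<eta> \<Phi>] linear_fun_of_mult[OF lin_y G])
    then obtain c1 where c1: "1 \<le> c1" and bound: "\<And>\<tau>. \<tau> \<in> D \<Longrightarrow>
        euclid_norm ((A *\<^sub>v X \<tau> + B *\<^sub>v U \<tau>) @\<^sub>v
        ((F *\<^sub>v X\<chi> \<tau> + L *\<^sub>v Y \<tau> + Bc *\<^sub>v U \<tau>) @\<^sub>v (\<Phi> *\<^sub>v X\<eta> \<tau> + G *\<^sub>v Y \<tau>))) \<le> c1 * euclid_norm (g \<tau>)"
      by (rule linear_fun_of_bounded) blast
    have "euclid_norm (x (Suc k) @\<^sub>v \<chi> (Suc k) @\<^sub>v \<eta> (Suc k)) \<le> c1 * euclid_norm (x k @\<^sub>v \<chi> k @\<^sub>v \<eta> k)"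
      if cl: "?cl x \<chi> \<eta> u y" for x \<chi> \<eta> u y k
    proof -
      let ?\<tau> = "(x, \<chi>, \<eta>, k)"
      have \<tau>: "?\<tau> \<in> D" using cl by (auto simp: D_def)
      have v: "X ?\<tau> = x k" "X\<chi> ?\<tau> = \<chi> k" "X\<eta> ?\<tau> = \<eta> k" by (simp_all add: X_def X\<chi>_def X\<eta>_def)
      have zero: "P *\<^sub>v 0\<^sub>v nw = 0\<^sub>v n" "Q *\<^sub>v 0\<^sub>v nw = 0\<^sub>v p" using P Q by (auto intro!: eq_vecI)
      have u: "u k = U ?\<tau>" using cl by (simp add: closed_loop_def U_def v)
      have y: "y k = Y ?\<tau>"
        using cl zero(2) mult_mat_vec_carrier[OF C c(1)[OF cl]]
        by (simp add: closed_loop_def plant_traj_def Y_def v)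
      have "u k \<in> carrier_vec m"
        unfolding u U_def by (intro mult_mat_vec_carrier[OF K] Dc(4)[OF \<tau>])
      then have "A *\<^sub>v x k + B *\<^sub>v u k \<in> carrier_vec n"
        using mult_mat_vec_carrier[OF A c(1)[OF cl]] mult_mat_vec_carrier[OF B] by (intro add_carrier_vec)
      moreover have "x (Suc k) = A *\<^sub>v x k + B *\<^sub>v u k + P *\<^sub>v 0\<^sub>v nw"
        using cl by (auto simp: closed_loop_def plant_traj_def)
      ultimately have "x (Suc k) = A *\<^sub>v X ?\<tau> + B *\<^sub>v U ?\<tau>"
        unfolding zero(1) u[symmetric] v by simp
      moreover have "\<chi> (Suc k) = F *\<^sub>v X\<chi> ?\<tau> + L *\<^sub>v Y ?\<tau> + Bc *\<^sub>v U ?\<tau>"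
        using cl unfolding closed_loop_def v u[symmetric] y[symmetric] by blast
      moreover have "\<eta> (Suc k) = \<Phi> *\<^sub>v X\<eta> ?\<tau> + G *\<^sub>v Y ?\<tau>"
        using cl unfolding closed_loop_def im_traj_def v y[symmetric] by blast
      ultimately show ?thesis using bound[OF \<tau>] by (simp add: g_def v)
    qed
    then show thesis by (rule that[OF c1])
  qed
  have first_steps: "euclid_norm (x k @\<^sub>v \<chi> k @\<^sub>v \<eta> k) \<le> c1 ^ k * euclid_norm (x 0 @\<^sub>v \<chi> 0 @\<^sub>v \<eta> 0)"
    if cl: "?cl x \<chi> \<eta> u y" for x \<chi> \<eta> u y k
  proof (induction k)
    case (Suc k)
    have "euclid_norm (x (Suc k) @\<^sub>v \<chi> (Suc k) @\<^sub>v \<eta> (Suc k)) \<le> c1 * euclid_norm (x k @\<^sub>v \<chi> k @\<^sub>v \<eta> k)"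
      by (rule one_step[OF cl])
    also have "\<dots> \<le> c1 * (c1 ^ k * euclid_norm (x 0 @\<^sub>v \<chi> 0 @\<^sub>v \<eta> 0))"
      using c1 Suc by (intro mult_left_mono) auto
    finally show ?case by (simp add: mult.assoc)
  qed simp
  have power: "\<chi> (l + j) @\<^sub>v \<eta> (l + j) = (\<Theta> ^\<^sub>m j) *\<^sub>v (\<chi> l @\<^sub>v \<eta> l)" if cl: "?cl x \<chi> \<eta> u y" for x \<chi> \<eta> u y j
  proof (induction j)
    case 0
    have "\<chi> l @\<^sub>v \<eta> l \<in> carrier_vec (nc + ne)" using c[OF cl] by auto
    then show ?case using \<Theta> by simp
  next
    case (Suc j)
    have "\<chi> l @\<^sub>v \<eta> l \<in> carrier_vec (nc + ne)" using c[OF cl] by auto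
    then show ?case
      using later[OF cl, of "l + j"] Suc assoc_mult_mat_vec[OF \<Theta>(1) pow_carrier_mat[OF \<Theta>(1)]]
      unfolding pow_mat_Suc_left[OF \<Theta>(1)] by simp
  qed
  \<comment> \<open>The factor \<open>entry_sum R + 1\<close> accounts for \<open>x k\<close> and for the controller state itself.\<close>
  define b where "b = (\<lambda>k. if k < l then c1 ^ k else (entry_sum R + 1) * entry_sum (\<Theta> ^\<^sub>m (k - l)) * c1 ^ l)"
  have "(\<lambda>k. (entry_sum R + 1) * entry_sum (\<Theta> ^\<^sub>m k) * c1 ^ l) \<longlonglongrightarrow> 0"
    by (intro tendsto_mult_left_zero tendsto_mult_right_zero \<Theta>)
  moreover have "b (k + l) = (entry_sum R + 1) * entry_sum (\<Theta> ^\<^sub>m k) * c1 ^ l" for k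
    by (simp add: b_def)
  ultimately have "(\<lambda>k. b (k + l)) \<longlonglongrightarrow> 0" by simp
  then have "b \<longlonglongrightarrow> 0" by (rule LIMSEQ_offset)
  then show ?thesis
  proof (rule origin_gas_if_decay_bound)
    fix z k assume "z \<in> ?Z"
    then obtain x \<chi> \<eta> u y where cl: "?cl x \<chi> \<eta> u y" and z: "z = (\<lambda>k. x k @\<^sub>v \<chi> k @\<^sub>v \<eta> k)" by blast
    show "euclid_norm (z k) \<le> b k * euclid_norm (z 0)"
    proof (cases "k < l")
      case True
      then show ?thesis using first_steps[OF cl, of k] by (simp add: z b_def)
    next
      case False
      define j where "j = k - l"
      have k: "k = l + j" using False by (simp add: j_def)
      have \<psi>: "\<chi> i @\<^sub>v \<eta> i \<in> carrier_vec (nc + ne)" for i using c[OF cl] by auto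
      have "euclid_norm (x k) \<le> entry_sum R * euclid_norm (\<chi> k @\<^sub>v \<eta> k)"
        using later[OF cl, of k] euclid_norm_mult_mat_vec_le[of "\<chi> k @\<^sub>v \<eta> k" R] \<psi> R False by auto
      then have "euclid_norm (z k) \<le> (entry_sum R + 1) * euclid_norm (\<chi> k @\<^sub>v \<eta> k)"
        using euclid_norm_append_le[of "x k" "\<chi> k @\<^sub>v \<eta> k"] by (simp add: z algebra_simps)
      also have "euclid_norm (\<chi> k @\<^sub>v \<eta> k) \<le> entry_sum (\<Theta> ^\<^sub>m j) * euclid_norm (\<chi> l @\<^sub>v \<eta> l)"
        unfolding k power[OF cl]
        by (rule euclid_norm_mult_mat_vec_le)
          (use \<psi>[of l] pow_carrier_mat[OF \<Theta>(1), of j] in \<open>simp only: carrier_matD\<close>)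
      also have "euclid_norm (\<chi> l @\<^sub>v \<eta> l) \<le> euclid_norm (z l)"
        unfolding z by (rule euclid_norm_append_right_le)
      also have "euclid_norm (z l) \<le> c1 ^ l * euclid_norm (z 0)"
        using first_steps[OF cl, of l] by (simp add: z)
      finally show ?thesis
        using False by (simp add: b_def j_def entry_sum_nonneg add_nonneg_nonneg mult_left_mono mult.assoc)
    qed
  qed
qed

section \<open>Data-driven output regulation\<close>

theorem theorem4p5:
  fixes S A B P C Q :: "real mat"
    and w x u y \<eta> :: "nat \<Rightarrow> real vec"
    and q :: "real poly"
    and U1 \<Psi>0 \<Psi>1 W0 L0 M X Y K :: "real mat"
    and nw n m p l T nwh d N :: nat
  assumes "S \<in> carrier_mat nw nw" and "A \<in> carrier_mat n n" and "B \<in> carrier_mat n m"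
    and "P \<in> carrier_mat n nw" and "C \<in> carrier_mat p n" and "Q \<in> carrier_mat p nw"
    and "\<forall>z :: complex. eigenvalue (map_mat complex_of_real S) z \<longrightarrow> cmod z \<ge> 1"
    and "observable A C" and "l = observability_index A C"
    and "is_minimal_poly S q" and "d = degree q"
    and "l \<le> T"
    and "plant_traj {..T} S A B P C Q w x u y"
    and "im_traj {..T} (im_Phi p q) (im_G p d) y \<eta>"
    and "N = (m + p) * l + p * d"
    and "U1 = data_mat m u l T"
    and "\<Psi>0 = data_mat N (psi l y u \<eta>) l T"
    and "\<Psi>1 = data_mat N (psi l y u \<eta>) (l + 1) (T + 1)"
    and "W0 = data_mat nw w l T"
    and "L0 \<in> carrier_mat nw nwh" and "M \<in> carrier_mat nwh (T - l + 1)" and "W0 = L0 * M"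
    and "sdp_feasible \<Psi>0 \<Psi>1 M X Y"
    and "K = U1 * Y * the (mat_inverse X)"
  shows "solves_output_regulation S A B P C Q
           (ctrl_F p m l) (ctrl_L p m l) (ctrl_B p m l) (im_Phi p q) (im_G p d) K"
proof -
  note S = assms(1) and A = assms(2) and B = assms(3) and P = assms(4) and C = assms(5) and Q = assms(6)
  have d: "d = degree q" and lT: "l \<le> T" by fact+
  let ?nc = "p * l + m * l"
  let ?ne = "p * d"
  have N: "N = p * l + (m * l + ?ne)" "N = ?nc + ?ne"
    using \<open>N = (m + p) * l + p * d\<close> by (simp_all add: add_mult_distrib)
  have \<Phi>: "im_Phi p q \<in> carrier_mat ?ne ?ne" and G: "im_G p d \<in> carrier_mat ?ne p"
    unfolding d by (rule im_carrier)+
  note F = ctrl_carrier(1)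
  have "\<not> eigenvalue (map_mat complex_of_real S) 0"
    using assms(7) by (metis norm_zero not_one_le_zero)
  then have det: "det S \<noteq> 0" by (rule det_nonzero_if_no_zero_eigenvalue[OF S])
  have l1: "1 \<le> l" and rank: "observability_rank A C l = n"
    using observability_index_rank[OF A C assms(8)] assms(9) by auto
  have monic: "lead_coeff q = 1" and annihilates: "poly_mat q S = 0\<^sub>m nw nw"
    using assms(10) S by (auto simp: is_minimal_poly_def)

  \<comment> \<open>\<open>D\<close> collects pieces of arbitrary trajectories, of the experiment as well as of the closed loop,
    in order to obtain common matrices \<open>H\<close> and \<open>Hx\<close>.\<close>
  define D where "D = {(w :: nat \<Rightarrow> real vec, x, u, y, \<eta>, k). l \<le> k \<and>
    plant_traj {k - l..k} S A B P C Q w x u y \<and> im_traj {k} (im_Phi p q) (im_G p d) y \<eta>}"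
  define g where "g = (\<lambda>(w :: nat \<Rightarrow> real vec, x :: nat \<Rightarrow> real vec, u, y, \<eta>, k).
    psi l y u \<eta> k @\<^sub>v (u k @\<^sub>v w k))"
  let ?w = "\<lambda>(w, x, u, y, \<eta>, k). w" let ?x = "\<lambda>(w, x, u, y, \<eta>, k). x"
  let ?u = "\<lambda>(w, x, u, y, \<eta>, k). u" let ?y = "\<lambda>(w, x, u, y, \<eta>, k). y"
  let ?\<eta> = "\<lambda>(w, x, u, y, \<eta>, k). \<eta>" let ?k = "\<lambda>(w, x, u, y, \<eta>, k). k"
  have g_eq: "g = (\<lambda>\<tau>. psi l (?y \<tau>) (?u \<tau>) (?\<eta> \<tau>) (?k \<tau>) @\<^sub>v (?u \<tau> (?k \<tau>) @\<^sub>v ?w \<tau> (?k \<tau>)))"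
    by (auto simp: g_def)
  have D': "l \<le> ?k \<tau>" "plant_traj {?k \<tau> - l..?k \<tau>} S A B P C Q (?w \<tau>) (?x \<tau>) (?u \<tau>) (?y \<tau>)"
    "im_traj {?k \<tau>} (im_Phi p q) (im_G p d) (?y \<tau>) (?\<eta> \<tau>)" if "\<tau> \<in> D" for \<tau>
    using that by (auto simp: D_def)
  have "linear_fun_of D (N + (m + nw)) g n (\<lambda>\<tau>. ?x \<tau> (?k \<tau>))"
    "linear_fun_of D (N + (m + nw)) g N (\<lambda>\<tau>. psi l (?y \<tau>) (?u \<tau>) (?\<eta> \<tau>) (Suc (?k \<tau>)))"
    unfolding g_eq N(1)
    by (rule psi_next_linear[OF S A B P C Q \<Phi> G rank det]; use D' in blast)+
  then obtain Hx H where Hx: "Hx \<in> carrier_mat n (N + (m + nw))"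
    "\<And>\<tau>. \<tau> \<in> D \<Longrightarrow> g \<tau> \<in> carrier_vec (N + (m + nw)) \<and> ?x \<tau> (?k \<tau>) = Hx *\<^sub>v g \<tau>"
    and H: "H \<in> carrier_mat N (N + (m + nw))"
    "\<And>\<tau>. \<tau> \<in> D \<Longrightarrow> psi l (?y \<tau>) (?u \<tau>) (?\<eta> \<tau>) (Suc (?k \<tau>)) = H *\<^sub>v g \<tau>"
    unfolding linear_fun_of_def by blast

  \<comment> \<open>Along the experiment, the recursion with \<open>H\<close> is an equation between data matrices.\<close>
  have exp: "(w, x, u, y, \<eta>, k) \<in> D" if "l \<le> k" "k \<le> T" for k
    using that assms(13,14) by (auto simp: D_def plant_traj_def im_traj_def)
  have "u k \<in> carrier_vec m" "w k \<in> carrier_vec nw" "psi l y u \<eta> k \<in> carrier_vec N" if "l \<le> k" "k \<le> T" for k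
  proof -
    show c: "u k \<in> carrier_vec m" "w k \<in> carrier_vec nw"
      using assms(13) B S that by (auto simp: plant_traj_def)
    show "psi l y u \<eta> k \<in> carrier_vec N"
      using Hx(2)[OF exp[OF that]] carrier_vecD[OF c(1)] carrier_vecD[OF c(2)]
      by (auto simp: g_def intro!: carrier_vecI dest!: carrier_vecD)
  qed
  note exp_c = this
  have \<Psi>1: "\<Psi>1 = H * (\<Psi>0 @\<^sub>r (U1 @\<^sub>r W0))"
  proof -
    have "\<Psi>1 = H * data_mat (N + (m + nw)) (\<lambda>k. psi l y u \<eta> k @\<^sub>v (u k @\<^sub>v w k)) l T"
      unfolding assms(18)
    proof (rule data_mat_eq_mult[OF H(1)])
      fix k assume "l \<le> k" "k \<le> T"
      from Hx(2)[OF exp[OF this]] H(2)[OF exp[OF this]]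
      show "psi l y u \<eta> k @\<^sub>v (u k @\<^sub>v w k) \<in> carrier_vec (N + (m + nw)) \<and>
          psi l y u \<eta> (Suc k) = H *\<^sub>v (psi l y u \<eta> k @\<^sub>v (u k @\<^sub>v w k))"
        by (simp add: g_def)
    qed
    moreover have "data_mat (N + (m + nw)) (\<lambda>k. psi l y u \<eta> k @\<^sub>v (u k @\<^sub>v w k)) l T = \<Psi>0 @\<^sub>r (U1 @\<^sub>r W0)"
      unfolding assms(16,17,19) using exp_c by (simp add: data_mat_append)
    ultimately show ?thesis by simp
  qed
  have Tl: "T - l + 1 = Suc T - l" using lT by simp
  have dims: "\<Psi>0 \<in> carrier_mat N (T - l + 1)" "U1 \<in> carrier_mat m (T - l + 1)"
    "W0 \<in> carrier_mat nw (T - l + 1)"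
    unfolding assms(16,17,19) Tl by (rule data_mat_carrier)+
  note M = \<open>M \<in> carrier_mat nwh (T - l + 1)\<close>
  let ?E = "1\<^sub>m N @\<^sub>r (K @\<^sub>r 0\<^sub>m nw N)"
  have K: "K \<in> carrier_mat m N" and stable: "(\<lambda>k. entry_sum ((H * ?E) ^\<^sub>m k)) \<longlonglongrightarrow> 0"
    using sdp_closed_loop_powers_tendsto_0[OF H(1) dims assms(20) M assms(22) \<Psi>1 assms(23,24)]
    by blast+
  have K0: "K @\<^sub>r 0\<^sub>m nw N \<in> carrier_mat (m + nw) N" using K by simp
  have E: "?E \<in> carrier_mat (N + (m + nw)) N" using K0 by simp

  \<comment> \<open>In the closed loop without exosignal, the same recursion is governed by \<open>\<Theta> = H ?E\<close>.\<close>
  let ?cl = "closed_loop S A B P C Q (ctrl_F p m l) (ctrl_L p m l) (ctrl_B p m l) (im_Phi p q) (im_G p d) K"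
  have later: "\<chi> (Suc k) @\<^sub>v \<eta> (Suc k) = (H * ?E) *\<^sub>v (\<chi> k @\<^sub>v \<eta> k) \<and> x k = (Hx * ?E) *\<^sub>v (\<chi> k @\<^sub>v \<eta> k)"
    if cl: "?cl (\<lambda>_. 0\<^sub>v nw) x \<chi> \<eta> u y" and k: "l \<le> k" for x \<chi> \<eta> u y k
  proof -
    have \<tau>: "(\<lambda>_. 0\<^sub>v nw, x, u, y, \<eta>, k) \<in> D"
      using cl k by (auto simp: D_def closed_loop_def plant_traj_def im_traj_def)
    have eq: "\<chi> k @\<^sub>v \<eta> k = psi l y u \<eta> k" if "l \<le> k" for k
      by (rule closed_loop_state_eq_psi[OF \<Phi> A B S C Q l1 that cl])
    have \<psi>: "\<chi> k @\<^sub>v \<eta> k \<in> carrier_vec N"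
      using cl F[of p m l] \<Phi> unfolding N(2)
      by (auto simp: closed_loop_def im_traj_def)
    have u: "u k = K *\<^sub>v (\<chi> k @\<^sub>v \<eta> k)" using cl by (simp add: closed_loop_def)
    have "0\<^sub>m nw N *\<^sub>v (\<chi> k @\<^sub>v \<eta> k) = 0\<^sub>v nw" using \<psi> by (intro eq_vecI) auto
    then have "g (\<lambda>_. 0\<^sub>v nw, x, u, y, \<eta>, k) = ?E *\<^sub>v (\<chi> k @\<^sub>v \<eta> k)"
      using mat_mult_append[OF one_carrier_mat K0 \<psi>] mat_mult_append[OF K zero_carrier_mat \<psi>, of nw] \<psi> u
        eq[OF k] by (simp add: g_def)
    then show ?thesis
      using Hx(2)[OF \<tau>] H(2)[OF \<tau>] eq[of "Suc k"] k assoc_mult_mat_vec[OF Hx(1) E \<psi>]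
        assoc_mult_mat_vec[OF H(1) E \<psi>] by simp
  qed
  let ?Z = "{z. \<exists>x \<chi> \<eta> u y. ?cl (\<lambda>_. 0\<^sub>v nw) x \<chi> \<eta> u y \<and> z = (\<lambda>k. x k @\<^sub>v \<chi> k @\<^sub>v \<eta> k)}"
  have "H * ?E \<in> carrier_mat N N" "Hx * ?E \<in> carrier_mat n N"
    using H(1) Hx(1) E by (auto intro: mult_carrier_mat)
  note in_N = K this
  have gas: "origin_gas ?Z"
    by (rule closed_loop_origin_gas[OF S A B P C Q ctrl_carrier \<Phi> G in_N(1,2)[unfolded N(2)]
        stable[unfolded N(2)] in_N(3)[unfolded N(2)], of l])
      (use later in \<open>simp add: N(2)\<close>)

  \<comment> \<open>Regulation: \<open>q(\<sigma>)\<close> turns a solution into one with zero exosignal, to which \<open>gas\<close> applies.\<close>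
  have "(\<lambda>k. euclid_norm (y k)) \<longlonglongrightarrow> 0" if cl: "?cl w x \<chi> \<eta> u y" for w x \<chi> \<eta> u y
  proof -
    have c: "w k \<in> carrier_vec nw" "w (Suc k) = S *\<^sub>v w k" "x k \<in> carrier_vec n" "y k = C *\<^sub>v x k + Q *\<^sub>v w k"
      "\<eta> k \<in> carrier_vec (p * degree q)" for k
      using cl S A \<Phi> d by (auto simp: closed_loop_def plant_traj_def im_traj_def)
    have y: "y k \<in> carrier_vec p" for k
      unfolding c(4) using C Q c by (intro add_carrier_vec mult_mat_vec_carrier)
    have "poly_shift q w = (\<lambda>_. 0\<^sub>v nw)"
    proof
      fix k
      have "0\<^sub>m nw nw *\<^sub>v w k = 0\<^sub>v nw" using c(1)[of k] by (intro eq_vecI) auto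
      then show "poly_shift q w k = 0\<^sub>v nw"
        using poly_shift_exosystem[of S nw w q k, OF S c(1,2)] annihilates by simp
    qed
    then have cl': "?cl (\<lambda>_. 0\<^sub>v nw) (poly_shift q x) (poly_shift q \<chi>) (poly_shift q \<eta>) (poly_shift q u) (poly_shift q y)"
      using closed_loop_poly_shift[OF S A B P C Q ctrl_carrier \<Phi> G K[unfolded N(2)] cl, of q] by simp
    define z where "z = (\<lambda>k. poly_shift q x k @\<^sub>v poly_shift q \<chi> k @\<^sub>v poly_shift q \<eta> k)"
    have "z \<in> ?Z" using cl' unfolding z_def by blast
    then have z: "(\<lambda>k. euclid_norm (z k)) \<longlonglongrightarrow> 0" using gas by (auto simp: origin_gas_def)
    obtain c0 where c0: "\<And>k. euclid_norm (y k) \<le> c0 * euclid_norm (z k)"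
    proof (cases "d = 0")
      case True
      \<comment> \<open>Then \<open>q = 1\<close> and the internal model is empty, but \<open>q(\<sigma>)\<close> leaves \<open>y\<close> unchanged.\<close>
      then have "poly_shift q y = y" using monic d by (intro ext eq_vecI) (auto simp: poly_shift_def)
      moreover have "Q *\<^sub>v 0\<^sub>v nw = 0\<^sub>v p" using Q by (intro eq_vecI) auto
      ultimately have "y k = C *\<^sub>v poly_shift q x k" for k
        using cl' mult_mat_vec_carrier[OF C poly_shift_carrier[of x _ n, OF c(3)]]
        by (simp add: closed_loop_def plant_traj_def)
      then have "euclid_norm (y k) \<le> entry_sum C * euclid_norm (poly_shift q x k)" for k
        using euclid_norm_mult_mat_vec_le[of "poly_shift q x k" C] poly_shift_carrier[of x _ n, OF c(3)] C by simp
      also have "entry_sum C * euclid_norm (poly_shift q x k) \<le> entry_sum C * euclid_norm (z k)" for k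
        unfolding z_def by (intro mult_left_mono euclid_norm_append_left_le entry_sum_nonneg)
      finally show thesis by (rule that)
    next
      case False
      have "y k = vec_first (poly_shift q \<eta> k) p" for k
      proof (rule eq_vecI)
        fix j assume "j < dim_vec (vec_first (poly_shift q \<eta> k) p)"
        then have "j < p" by simp
        then have "poly_shift q \<eta> k $ j = y k $ j"
          by (intro internal_model_poly_shift[of q y p \<eta>, OF monic _ y c(5)])
            (use False d cl in \<open>auto simp: closed_loop_def im_traj_def\<close>)
        then show "y k $ j = vec_first (poly_shift q \<eta> k) p $ j"
          using \<open>j < p\<close> by (simp add: vec_first_def)
      qed (use y in simp)
      moreover have "poly_shift q \<eta> k \<in> carrier_vec (p + (p * d - p))" for k
        using poly_shift_carrier[of \<eta> k "p * degree q" q, OF c(5)] False d by (cases d) auto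
      ultimately have "poly_shift q \<eta> k = y k @\<^sub>v vec_last (poly_shift q \<eta> k) (p * d - p)" for k
        by simp
      then have "euclid_norm (y k) \<le> euclid_norm (poly_shift q \<eta> k)" for k
        by (metis euclid_norm_append_left_le)
      also have "euclid_norm (poly_shift q \<eta> k) \<le> 1 * euclid_norm (z k)" for k
        unfolding z_def using euclid_norm_append_right_le[of "poly_shift q \<eta> k"]
        by (metis append_vec_assoc mult_1)
      finally show thesis by (rule that)
    qed
    show ?thesis
    proof (rule tendsto_sandwich[of "\<lambda>_. 0"])
      show "(\<lambda>k. c0 * euclid_norm (z k)) \<longlonglongrightarrow> 0" by (rule tendsto_mult_right_zero[OF z])
      show "\<forall>\<^sub>F k in sequentially. euclid_norm (y k) \<le> c0 * euclid_norm (z k)" using c0 by simp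
      show "\<forall>\<^sub>F k in sequentially. 0 \<le> euclid_norm (y k)" using euclid_norm_nonneg by simp
    qed simp
  qed
  then show ?thesis
    using gas S unfolding solves_output_regulation_def by simp
qed

end
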